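(* There exists a meromorphic function $f$ on $\mathbb{C}$ with $\delta(\infty,f)=0$ which has a wandering domain $W$ such that: (a) $W$ is an escaping wandering domain, $h(z):=\overline{h}(z)=\underline{h}(z)$ exists on $W$ (that is, $\overline{h}$ and $\underline{h}$ coincide on $W$), and $h$ is a non-constant positive harmonic function on $W$. (b) For any point $z_0\in W$ and any neighborhood $V$ of $z_0$ in $W$, there is a constant $0<\alpha<1$ such that for all sufficiently large $n$ $$f^n(V)\supset A(|f^n(z_0)|^{1-\alpha},|f^n(z_0)|^{1+\alpha}).$$ (c) Moreover, for such $z_0$ and $V$, there exist two points $a$ and $b$ in $V$ and $\tau>1$ such that for all sufficiently large $n$ $$|f^n(a)|^\tau\leq |f^n(b)|$$ and $$A_n=A(r_n,R_n)\subseteq f^n(V),\quad R_n\geq r_n^\tau,\quad A_{n+1}\subseteq f(A_n),$$ where $r_n^\tau\to\infty$ $(n\to\infty)$.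
   Context: For a meromorphic function $f$ on $\mathbb{C}$ that is not a Möbius transformation, $f^n$ denotes the $n$th iterate. The Fatou set $F(f)$ is the set of points $z\in\hat{\mathbb{C}}$ such that $\{f^n\}_{n\in\mathbb{N}}$ is well-defined and forms a normal family in some neighborhood of $z$. A Fatou component is a connected component $U$ of $F(f)$; $U_n$ denotes the component of $F(f)$ with $f^n(U)\subseteq U_n$. $U$ is escaping if $f^n|_U\to\infty$ as $n\to\infty$. $U$ is a wandering domain if $U_m\neq U_n$ for any pair of positive integers $m\neq n$. For $0<r<R$, $A(r,R)=\{z:\ r<|z|<R\}$. $T(r,f)=m(r,f)+N(r,f)$ is the Nevanlinna characteristic, where $m(r,f)=\frac{1}{2\pi}\int_0^{2\pi}\log^+|f(re^{i\theta})|\,d\theta$, $N(r,f)=\int_0^r\frac{n(t,f)-n(0,f)}{t}\,dt+n(0,f)\log r$, and $n(t,f)$ is the number of poles of $f$ in $\{|z|<t\}$ counted with multiplicity ($n(0,f)$ being the multiplicity of the pole at $0$). The Nevanlinna deficiency of poles is $\delta(\infty,f)=\liminf_{r\to\infty}\frac{m(r,f)}{T(r,f)}$. For an escaping Fatou component $W$ and a fixed base point $z_*\in W$, define for $z\in W$ (and $n$ large enough) $$h_n(z)=\frac{\log|f^n(z)|}{\log|f^n(z_* )|},\quad \overline{h}(z)=\limsup_{n\to\infty}h_n(z),\quad \underline{h}(z)=\liminf_{n\to\infty}h_n(z).$$ The assertion about $h$ is for any choice of base point $z_*\in W$. *)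

theory Defs
  imports "HOL-Complex_Analysis.Complex_Analysis"
begin

section \<open>The Riemann sphere with the chordal metric\<close>

datatype rsphere = Fin complex | Infinity

text \<open>Inverse stereographic projection onto the unit sphere of \<open>\<complex> \<times> \<real>\<close>, whose product
  norm is Euclidean; the metric on \<open>rsphere\<close> is the one pulled back along it.\<close>

primrec stereo :: "rsphere \<Rightarrow> complex \<times> real" where
  "stereo (Fin z) =
     ((2 / (1 + (cmod z)\<^sup>2)) *\<^sub>R z, ((cmod z)\<^sup>2 - 1) / ((cmod z)\<^sup>2 + 1))"
| "stereo Infinity = (0, 1)"

lemma snd_stereo_Fin: "snd (stereo (Fin z)) = 1 - 2 / (1 + (cmod z)\<^sup>2)"
proof -
  have "1 + (cmod z)\<^sup>2 > 0" by (simp add: add_pos_nonneg)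
  then show ?thesis by (simp add: field_simps)
qed

lemma stereo_eq_iff [simp]: "stereo x = stereo y \<longleftrightarrow> x = y"
proof
  assume eq: "stereo x = stereo y"
  have pos: "1 + (cmod z)\<^sup>2 > 0" for z :: complex by (simp add: add_pos_nonneg)
  show "x = y"
  proof (cases x; cases y)
    fix z w assume xy: "x = Fin z" "y = Fin w"
    have "2 / (1 + (cmod z)\<^sup>2) = 2 / (1 + (cmod w)\<^sup>2)"
      using eq snd_stereo_Fin[of z] snd_stereo_Fin[of w] xy by simp
    moreover have "(2 / (1 + (cmod z)\<^sup>2)) *\<^sub>R z = (2 / (1 + (cmod w)\<^sup>2)) *\<^sub>R w"
      using eq xy by simp
    moreover have "2 / (1 + (cmod w)\<^sup>2) \<noteq> 0" using pos[of w] by simp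
    ultimately show "x = y" using xy by (metis scaleR_cancel_left)
  next
    fix z assume xy: "x = Fin z" "y = Infinity"
    then have "2 / (1 + (cmod z)\<^sup>2) = 0" using eq snd_stereo_Fin[of z] by simp
    then show "x = y" using pos[of z] by simp
  next
    fix z assume xy: "x = Infinity" "y = Fin z"
    then have "2 / (1 + (cmod z)\<^sup>2) = 0" using eq snd_stereo_Fin[of z] by simp
    then show "x = y" using pos[of z] by simp
  qed auto
qed auto

instantiation rsphere :: metric_space
begin

definition dist_rsphere :: "rsphere \<Rightarrow> rsphere \<Rightarrow> real" where
  "dist_rsphere x y = dist (stereo x) (stereo y)"

definition uniformity_rsphere :: "(rsphere \<times> rsphere) filter" where
  "uniformity_rsphere = (INF e\<in>{0<..}. principal {(x, y). dist x y < e})"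

definition open_rsphere :: "rsphere set \<Rightarrow> bool" where
  "open_rsphere U \<longleftrightarrow> (\<forall>x\<in>U. eventually (\<lambda>(x', y). x' = x \<longrightarrow> y \<in> U) uniformity)"

instance
proof
  fix x y z :: rsphere
  show "dist x y = 0 \<longleftrightarrow> x = y" by (simp add: dist_rsphere_def)
  show "dist x y \<le> dist x z + dist y z"
    unfolding dist_rsphere_def by (rule dist_triangle2)
qed (simp_all add: uniformity_rsphere_def open_rsphere_def)

end

section \<open>Iteration of meromorphic functions\<close>

definition is_moebius :: "(complex \<Rightarrow> complex) \<Rightarrow> bool" where
  "is_moebius f \<longleftrightarrow> (\<exists>a b c d. a * d - b * c \<noteq> 0 \<and>
     (\<forall>z. c * z + d \<noteq> 0 \<longrightarrow> f z = (a * z + b) / (c * z + d)))"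

definition sphere_eval :: "(complex \<Rightarrow> complex) \<Rightarrow> complex \<Rightarrow> rsphere" where
  "sphere_eval f z = (if is_pole f z then Infinity else Fin (f z))"

text \<open>A meromorphic function on \<open>\<complex>\<close> as a partial self-map of the sphere.  Its value at infinity
  is defined exactly when a limit exists in the sphere, that is, when the function is rational.\<close>

primrec sphere_map :: "(complex \<Rightarrow> complex) \<Rightarrow> rsphere \<rightharpoonup> rsphere" where
  "sphere_map f (Fin z) = Some (sphere_eval f z)"
| "sphere_map f Infinity =
     (if \<exists>L. (sphere_eval f \<longlongrightarrow> L) at_infinity
      then Some (Lim at_infinity (sphere_eval f)) else None)"

primrec partial_iter :: "(complex \<Rightarrow> complex) \<Rightarrow> nat \<Rightarrow> rsphere \<rightharpoonup> rsphere" where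
  "partial_iter f 0 x = Some x"
| "partial_iter f (Suc n) x = Option.bind (partial_iter f n x) (sphere_map f)"

text \<open>Meaningful only where the \<open>n\<close>-th iterate is well-defined, in particular on the Fatou set.\<close>

definition sphere_iter :: "(complex \<Rightarrow> complex) \<Rightarrow> nat \<Rightarrow> rsphere \<Rightarrow> rsphere" where
  "sphere_iter f n x = the (partial_iter f n x)"

text \<open>The iterates as complex-valued functions.  The value infinity is mapped to \<open>0\<close>, a point
  contained in no annulus centred at \<open>0\<close>.\<close>

primrec fin_part :: "rsphere \<Rightarrow> complex" where
  "fin_part (Fin z) = z"
| "fin_part Infinity = 0"

definition iter :: "(complex \<Rightarrow> complex) \<Rightarrow> nat \<Rightarrow> complex \<Rightarrow> complex" where
  "iter f n z = fin_part (sphere_iter f n (Fin z))"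

text \<open>Locally uniform convergence, which on open subsets of the (compact) sphere is uniform
  convergence on compact subsets.\<close>

definition loc_uniform_limit ::
    "rsphere set \<Rightarrow> (nat \<Rightarrow> rsphere \<Rightarrow> rsphere) \<Rightarrow> (rsphere \<Rightarrow> rsphere) \<Rightarrow> bool" where
  "loc_uniform_limit V g l \<longleftrightarrow>
     (\<forall>K. compact K \<and> K \<subseteq> V \<longrightarrow> uniform_limit K g l sequentially)"

definition normal_family_on :: "(rsphere \<Rightarrow> rsphere) set \<Rightarrow> rsphere set \<Rightarrow> bool" where
  "normal_family_on \<F> V \<longleftrightarrow>
     (\<forall>g :: nat \<Rightarrow> rsphere \<Rightarrow> rsphere. range g \<subseteq> \<F> \<longrightarrow>
        (\<exists>k l. strict_mono k \<and> loc_uniform_limit V (g \<circ> k) l))"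

definition Fatou_set :: "(complex \<Rightarrow> complex) \<Rightarrow> rsphere set" where
  "Fatou_set f = {x. \<exists>V. open V \<and> x \<in> V \<and>
     (\<forall>n. \<forall>y\<in>V. partial_iter f n y \<noteq> None) \<and>
     normal_family_on (range (sphere_iter f)) V}"

definition Fatou_component :: "(complex \<Rightarrow> complex) \<Rightarrow> rsphere set \<Rightarrow> bool" where
  "Fatou_component f U \<longleftrightarrow> U \<in> components (Fatou_set f)"

definition escaping :: "(complex \<Rightarrow> complex) \<Rightarrow> rsphere set \<Rightarrow> bool" where
  "escaping f U \<longleftrightarrow> loc_uniform_limit U (sphere_iter f) (\<lambda>_. Infinity)"

text \<open>The components \<open>C n\<close> below are uniquely determined, as distinct components are disjoint.\<close>

definition wandering_domain :: "(complex \<Rightarrow> complex) \<Rightarrow> rsphere set \<Rightarrow> bool" where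
  "wandering_domain f U \<longleftrightarrow> Fatou_component f U \<and>
     (\<exists>C :: nat \<Rightarrow> rsphere set.
        (\<forall>n. Fatou_component f (C n) \<and> sphere_iter f n ` U \<subseteq> C n) \<and>
        (\<forall>m n. m \<ge> 1 \<and> n \<ge> 1 \<and> m \<noteq> n \<longrightarrow> C m \<noteq> C n))"

definition annulus :: "real \<Rightarrow> real \<Rightarrow> complex set" where
  "annulus r R = {z. r < cmod z \<and> cmod z < R}"

section \<open>Nevanlinna characteristic and deficiency of poles\<close>

definition proximity :: "real \<Rightarrow> (complex \<Rightarrow> complex) \<Rightarrow> real" where
  "proximity r f =
     1 / (2 * pi) * integral {0..2 * pi} (\<lambda>\<theta>. ln (max 1 (cmod (f (of_real r * cis \<theta>)))))"

definition pole_mult :: "(complex \<Rightarrow> complex) \<Rightarrow> complex \<Rightarrow> nat" where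
  "pole_mult f z = (if is_pole f z then nat (- zorder f z) else 0)"

definition pole_count :: "real \<Rightarrow> (complex \<Rightarrow> complex) \<Rightarrow> nat" where
  "pole_count t f = (\<Sum>z | cmod z < t \<and> is_pole f z. pole_mult f z)"

definition pole_count_integrated :: "real \<Rightarrow> (complex \<Rightarrow> complex) \<Rightarrow> real" where
  "pole_count_integrated r f =
     integral {0..r} (\<lambda>t. (real (pole_count t f) - real (pole_mult f 0)) / t)
       + real (pole_mult f 0) * ln r"

definition nevanlinna_T :: "real \<Rightarrow> (complex \<Rightarrow> complex) \<Rightarrow> real" where
  "nevanlinna_T r f = proximity r f + pole_count_integrated r f"

definition pole_deficiency :: "(complex \<Rightarrow> complex) \<Rightarrow> ereal" where
  "pole_deficiency f = Liminf at_top (\<lambda>r :: real. ereal (proximity r f / nevanlinna_T r f))"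

section \<open>Harmonic functions and the functions \<open>h\<close>\<close>

text \<open>Twice continuously (real) differentiable with vanishing Laplacian; \<open>1\<close> and \<open>\<i>\<close> are the
  coordinate directions.\<close>

definition harmonic_on :: "complex set \<Rightarrow> (complex \<Rightarrow> real) \<Rightarrow> bool" where
  "harmonic_on S u \<longleftrightarrow> open S \<and>
     (\<exists>(u' :: complex \<Rightarrow> complex \<Rightarrow>\<^sub>L real) (u'' :: complex \<Rightarrow> complex \<Rightarrow>\<^sub>L complex \<Rightarrow>\<^sub>L real).
        (\<forall>z\<in>S. (u has_derivative blinfun_apply (u' z)) (at z)) \<and>
        (\<forall>z\<in>S. (u' has_derivative blinfun_apply (u'' z)) (at z)) \<and>
        continuous_on S u'' \<and>
        (\<forall>z\<in>S. blinfun_apply (blinfun_apply (u'' z) 1) 1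
               + blinfun_apply (blinfun_apply (u'' z) \<i>) \<i> = 0))"

definition h_seq :: "(complex \<Rightarrow> complex) \<Rightarrow> complex \<Rightarrow> nat \<Rightarrow> complex \<Rightarrow> real" where
  "h_seq f zs n z = ln (cmod (iter f n z)) / ln (cmod (iter f n zs))"

definition h_upper :: "(complex \<Rightarrow> complex) \<Rightarrow> complex \<Rightarrow> complex \<Rightarrow> ereal" where
  "h_upper f zs z = limsup (\<lambda>n. ereal (h_seq f zs n z))"

definition h_lower :: "(complex \<Rightarrow> complex) \<Rightarrow> complex \<Rightarrow> complex \<Rightarrow> ereal" where
  "h_lower f zs z = liminf (\<lambda>n. ereal (h_seq f zs n z))"

end

theory Submission
  imports Defs
begin

text \<open>
  The function \<open>f\<close> is a sum of rational functions that is within \<open>1/4\<close> of \<open>z\<^sup>2\<close> on a sequence of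
  annuli \<open>{2 a\<^sub>k \<le> |z| \<le> b\<^sub>k / 2}\<close>, and within \<open>1/4\<close> of \<open>0\<close> on a disc around \<open>0\<close> and on the
  annuli \<open>{2 b\<^sub>k \<le> |z| \<le> a\<^bsub>k+1\<^esub> / 2}\<close> in between; its poles lie on the circles of
  radii \<open>a\<^sub>k\<close> and \<open>b\<^sub>k\<close>.  As \<open>|f| < 1\<close> on arbitrarily large circles, the deficiency of the
  poles vanishes.

  The radii satisfy \<open>a\<^bsub>k+1\<^esub> = 16 a\<^sub>k\<^sup>2\<close> and \<open>b\<^bsub>k+1\<^esub> = b\<^sub>k\<^sup>2 / 16\<close>, so the boundary circles of the
  annuli of the first kind are mapped into the region where \<open>f\<close> is small, and from there into the unit disc
  forever.  These circles therefore separate the set of points whose orbits move up through the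
  annuli, one annulus per step, from the rest of the Fatou set, and the components of the interior of
  that set are wandering domains.  The points near the middle of the first annulus belong to it.

  Since \<open>f z = z\<^sup>2 exp (small)\<close> along such orbits, \<open>2\<^sup>-\<^sup>n log |f\<^sup>n|\<close> converges uniformly
  to \<open>log |z| + Re q\<close> with \<open>q\<close> holomorphic and small.  This gives \<open>h\<close>; the covering
  properties follow because \<open>f\<^sup>n = exp (2\<^sup>n g\<^sub>n)\<close> locally, where \<open>g\<^sub>n\<close> converges uniformly
  to a non-constant holomorphic function.
\<close>

section \<open>The function\<close>

text \<open>A rational approximation of the indicator function of \<open>|z| > 2 ^ m\<close>.  The exponent makes the error
  on \<open>off_circle m\<close>, even after multiplication by \<open>z\<^sup>2\<close>, summable in \<open>k\<close>.  It is even, so that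
  \<open>sq_map\<close> is an even function and hence not a Moebius transformation.\<close>

definition circ_step :: "nat \<Rightarrow> nat \<Rightarrow> complex \<Rightarrow> complex" where
  "circ_step m k z = (z / 2 ^ m) ^ (2 * (m + k + 4)) / (1 + (z / 2 ^ m) ^ (2 * (m + k + 4)))"

definition off_circle :: "nat \<Rightarrow> complex \<Rightarrow> bool" where
  "off_circle m z \<longleftrightarrow> 2 * cmod z \<le> 2 ^ m \<or> 2 * 2 ^ m \<le> cmod z"

lemma circ_step_minus: "circ_step m k (- z) = circ_step m k z"
  by (simp add: circ_step_def)

text \<open>With \<open>x = z / 2 ^ m\<close> the quotient is at most \<open>2 * (1/2) ^ N\<close>,
  while \<open>|z|^2 <= 4 ^ m / 4\<close>. The summand \<open>2 * m\<close> of the exponent cancels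
  \<open>4 ^ m\<close>, and the rest leaves decay in \<open>k\<close>.\<close>

lemma circ_step_small:
  assumes "2 * cmod z \<le> 2 ^ m"
  shows "cmod (z\<^sup>2 * circ_step m k z) \<le> (1/2) ^ (k + 4)"
proof -
  define x where "x = z / 2 ^ m"
  define N where "N = 2 * (m + k + 4)"
  have four: "((2::real) ^ j)\<^sup>2 = 4 ^ j" for j by (simp add: power2_eq_square flip: power_mult_distrib)
  have x: "cmod x \<le> 1/2" using assms by (simp add: x_def norm_divide norm_power field_simps)
  have xN: "cmod x ^ N \<le> (1/2) ^ N" by (rule power_mono[OF x]) simp
  also have "\<dots> \<le> (1/2) ^ 1" by (rule power_decreasing) (auto simp: N_def)
  finally have "cmod (1 + x ^ N) \<ge> 1/2"
    using norm_triangle_ineq2[of 1 "- (x ^ N)"] by (simp add: norm_power)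
  then have "cmod (x ^ N / (1 + x ^ N)) \<le> (1/2) ^ N / (1/2)"
    unfolding norm_divide norm_power using xN by (intro frac_le) auto
  moreover have "cmod (z\<^sup>2) \<le> (2 ^ m) ^ 2 / 4"
    unfolding norm_power using power_mono[of "2 * cmod z" "2 ^ m" 2] assms by (simp add: power_mult_distrib)
  ultimately have "cmod (z\<^sup>2) * cmod (x ^ N / (1 + x ^ N)) \<le> ((2 ^ m) ^ 2 / 4) * ((1/2) ^ N / (1/2))"
    by (intro mult_mono) auto
  also have "\<dots> = (1/2) ^ (k + 4) * ((1/2) ^ (k + 5))"
    by (simp add: N_def four power_add power_mult power_divide flip: power_mult_distrib)
  also have "\<dots> \<le> (1/2) ^ (k + 4) * 1"
    by (intro mult_left_mono power_le_one) auto
  finally show ?thesis unfolding circ_step_def x_def N_def by (simp only: norm_mult)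
qed

text \<open>The difference \<open>circ_step m k z - 1\<close> is
  \<open>- 1 / (1 + x ^ (M + 2))\<close>. Two of the powers of \<open>x\<close> absorb
  \<open>|z|^2 = 4 ^ m |x|^2\<close>, and the other \<open>M\<close> give the decay.\<close>

lemma circ_step_large:
  assumes "2 * 2 ^ m \<le> cmod z"
  shows "cmod (z\<^sup>2 * (circ_step m k z - 1)) \<le> (1/2) ^ (k + 4)"
proof -
  define x where "x = z / 2 ^ m"
  define M where "M = 2 * (m + k + 3)"
  have four: "((2::real) ^ j)\<^sup>2 = 4 ^ j" for j by (simp add: power2_eq_square flip: power_mult_distrib)
  have x: "cmod x \<ge> 2" using assms by (simp add: x_def norm_divide norm_power field_simps)
  have z: "z = 2 ^ m * x" by (simp add: x_def)
  have N: "2 * (m + k + 4) = M + 2" by (simp add: M_def)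
  have xM: "cmod x ^ M \<ge> 2 ^ M" by (rule power_mono[OF x]) simp
  have "cmod x ^ (M + 2) \<ge> 2 ^ (M + 2)" by (rule power_mono[OF x]) simp
  moreover have "(2::real) ^ (M + 2) \<ge> 2" using power_increasing[of 1 "M + 2" "2::real"] by simp
  ultimately have ge2: "cmod x ^ (M + 2) \<ge> 2" by linarith
  have lb: "cmod (1 + x ^ (M + 2)) \<ge> cmod x ^ (M + 2) / 2"
    using norm_triangle_ineq2[of "x ^ (M + 2)" "- 1"] ge2
    by (simp add: norm_power norm_minus_commute add.commute del: power_Suc add_2_eq_Suc')
  with ge2 have nz: "1 + x ^ (M + 2) \<noteq> 0" by (auto simp del: power_Suc add_2_eq_Suc')
  have "circ_step m k z - 1 = - 1 / (1 + x ^ (M + 2))"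
    using nz unfolding circ_step_def N x_def[symmetric] by (simp add: field_simps)
  then have "cmod (z\<^sup>2 * (circ_step m k z - 1)) = cmod z ^ 2 / cmod (1 + x ^ (M + 2))"
    by (simp add: norm_mult norm_divide norm_power)
  also have "\<dots> \<le> cmod z ^ 2 / (cmod x ^ (M + 2) / 2)"
    using lb ge2 by (intro divide_left_mono) (auto simp del: power_Suc add_2_eq_Suc' intro!: mult_pos_pos)
  also have "\<dots> = 2 * (2 ^ m)\<^sup>2 / cmod x ^ M"
  proof -
    have "cmod z ^ 2 = (2 ^ m)\<^sup>2 * (cmod x)\<^sup>2"
      unfolding z norm_mult norm_power power_mult_distrib by simp
    moreover have "cmod x ^ (M + 2) = cmod x ^ M * (cmod x)\<^sup>2" by (rule power_add)
    moreover have "cmod x \<noteq> 0" using x by auto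
    ultimately show ?thesis by (simp only: times_divide_eq_right divide_divide_eq_right) (simp add: field_simps)
  qed
  also have "\<dots> \<le> 2 * (2 ^ m)\<^sup>2 / 2 ^ M"
    using xM x by (intro divide_left_mono) (auto intro!: mult_pos_pos zero_less_power)
  also have "\<dots> = (1/2) ^ (k + 4) * ((1/2) ^ (k + 1))"
    by (simp add: M_def four power_add power_mult power_divide field_simps flip: power_mult_distrib)
  also have "\<dots> \<le> (1/2) ^ (k + 4) * 1"
    by (intro mult_left_mono power_le_one) auto
  finally show ?thesis by simp
qed

text \<open>The poles are the points where an even power of \<open>z / 2 ^ m\<close> equals
  \<open>- 1\<close>, so they have modulus \<open>2 ^ m\<close>.\<close>

lemma circ_step_analytic:
  assumes "cmod z \<noteq> 2 ^ m"
  shows "circ_step m k analytic_on {z}"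
proof -
  have "1 + (z / 2 ^ m) ^ (2 * (m + k + 4)) \<noteq> 0"
  proof
    assume "1 + (z / 2 ^ m) ^ (2 * (m + k + 4)) = 0"
    then have "(z / 2 ^ m) ^ (2 * (m + k + 4)) = - 1" by (simp add: eq_neg_iff_add_eq_0 add.commute)
    then have "cmod (z / 2 ^ m) ^ (2 * (m + k + 4)) = 1" by (metis norm_minus_cancel norm_one norm_power)
    then have "cmod (z / 2 ^ m) = 1" by (intro power_eq_imp_eq_base[of _ "2 * (m + k + 4)" 1]) auto
    then show False using assms by (simp add: norm_divide norm_power)
  qed
  then show ?thesis unfolding circ_step_def by (intro analytic_intros) auto
qed

lemma circ_step_meromorphic: "circ_step m k meromorphic_on A"
  unfolding circ_step_def by (intro meromorphic_intros)

text \<open>The radii \<open>a\<^sub>k\<close> and \<open>b\<^sub>k\<close> are \<open>2 ^ inner_exp k\<close> and \<open>2 ^ outer_exp k\<close>.\<close>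

definition inner_exp :: "nat \<Rightarrow> nat" where "inner_exp k = 32 * 2 ^ k - 4"
definition outer_exp :: "nat \<Rightarrow> nat" where "outer_exp k = 48 * 2 ^ k + 4"

lemma inner_exp_add: "inner_exp k + 4 = 32 * 2 ^ k"
  unfolding inner_exp_def by (simp add: le_add_diff_inverse2 trans_le_add1)

lemma two_pow_le: "i < k \<Longrightarrow> 2 * 2 ^ i \<le> (2::nat) ^ k"
  using power_increasing[of "Suc i" k "2::nat"] by simp

text \<open>The coefficients 32 < 48 < 64 put the radii in the order
  \<open>a\<^sub>0 < b\<^sub>0 < a\<^sub>1 < ...\<close>, and the offsets 4 still leave a factor of
  at least 4 between neighbours. Doubling one radius and halving the next thus gives a nonempty
  annulus.\<close>

lemma exps_less: "inner_exp k + 2 \<le> outer_exp k" "i < k \<Longrightarrow> outer_exp i + 2 \<le> inner_exp k"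
  using inner_exp_add[of k] two_pow_le[of i k] one_le_power[of "2::nat" i] unfolding outer_exp_def
  by linarith+

lemma less_inner_exp: "k < inner_exp k" "k < outer_exp k"
  using inner_exp_add[of k] less_exp[of k] unfolding outer_exp_def by linarith+

text \<open>Beyond the outer circle the two steps cancel, so this approximates
  \<open>z\<^sup>2\<close> between the two circles and 0 elsewhere.\<close>

definition bump :: "nat \<Rightarrow> complex \<Rightarrow> complex" where
  "bump k z = z\<^sup>2 * (circ_step (inner_exp k) k z - circ_step (outer_exp k) k z)"

definition bumps :: "complex \<Rightarrow> complex" where "bumps z = (\<Sum>k. bump k z)"

text \<open>\<open>bumps\<close> has junk values at the poles, where \<open>x / 0 = 0\<close>.\<close>

definition sq_map :: "complex \<Rightarrow> complex" where "sq_map = remove_sings bumps"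

section \<open>Convergence and meromorphy of the series\<close>

lemma bump_small:
  assumes "2 * cmod z \<le> 2 ^ inner_exp k" "2 * cmod z \<le> 2 ^ outer_exp k"
  shows "cmod (bump k z) \<le> (1/2) ^ (k + 3)"
proof -
  have "cmod (bump k z) \<le> (1/2) ^ (k + 4) + (1/2) ^ (k + 4)"
    unfolding bump_def right_diff_distrib
    by (rule norm_triangle_le_diff[OF add_mono[OF circ_step_small circ_step_small]]) (use assms in auto)
  also have "\<dots> = (1/2) ^ (k + 3)" by (simp add: power_add power_numeral_reduce)
  finally show ?thesis .
qed

text \<open>Both exponents of bump \<open>k\<close> exceed \<open>k\<close>, so the disc of radius
  \<open>2 ^ K\<close> lies inside both circles by a factor 2 whenever \<open>k >= K\<close>. This
  is the uniform bound for the tail.\<close>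

lemma bump_small':
  assumes "cmod z \<le> 2 ^ K" "K \<le> k"
  shows "cmod (bump k z) \<le> (1/2) ^ (k + 3)"
proof -
  have *: "2 * cmod z \<le> 2 ^ n" if "k < n" for n
  proof -
    have "2 * (2::real) ^ K \<le> 2 ^ n"
      using power_increasing[of "Suc K" n "2::real"] that assms(2) by simp
    then show ?thesis using assms(1) by simp
  qed
  show ?thesis by (intro bump_small * less_inner_exp)
qed

text \<open>From index \<open>K\<close> on, all pole circles lie outside the disc, and the geometric
  bound allows the Weierstrass test.\<close>

lemma bumps_tail_holomorphic:
  "(\<lambda>z. \<Sum>k. bump (k + K) z) holomorphic_on ball 0 (2 ^ K)"
proof (rule holomorphic_uniform_sequence)
  show "(\<lambda>z. \<Sum>k<n. bump (k + K) z) holomorphic_on ball 0 (2 ^ K)" for n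
  proof (intro holomorphic_on_sum analytic_imp_holomorphic)
    fix k assume "k \<in> {..<n}"
    show "bump (k + K) analytic_on ball 0 (2 ^ K)"
      unfolding bump_def
    proof (intro analytic_intros)
      have *: "circ_step m j analytic_on ball 0 (2 ^ K)" if "K < m" for m j
      proof (subst analytic_on_analytic_at, safe)
        fix z :: complex assume "z \<in> ball 0 (2 ^ K)"
        moreover have "(2::real) ^ K \<le> 2 ^ m" using that by (intro power_increasing) auto
        ultimately show "circ_step m j analytic_on {z}" by (intro circ_step_analytic) auto
      qed
      show "circ_step (inner_exp (k + K)) (k + K) analytic_on ball 0 (2 ^ K)"
        "circ_step (outer_exp (k + K)) (k + K) analytic_on ball 0 (2 ^ K)"
        using less_inner_exp[of "k + K"] by (auto intro!: *)
    qed
  qed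
next
  fix x :: complex assume "x \<in> ball 0 (2 ^ K)"
  then obtain d where d: "d > 0" "cball x d \<subseteq> ball 0 (2 ^ K)"
    using open_contains_cball open_ball by blast
  moreover have "uniform_limit (cball x d) (\<lambda>n z. \<Sum>k<n. bump (k + K) z) (\<lambda>z. \<Sum>k. bump (k + K) z) sequentially"
  proof (rule Weierstrass_m_test)
    show "norm (bump (n + K) z) \<le> (1/2) ^ n" if "z \<in> cball x d" for n z
    proof -
      have "cmod z < 2 ^ K" using that d(2) by auto
      then have "cmod (bump (n + K) z) \<le> (1/2) ^ (n + K + 3)" by (intro bump_small'[of z K]) auto
      also have "\<dots> \<le> (1/2) ^ n" by (rule power_decreasing) auto
      finally show ?thesis .
    qed
  qed (simp add: summable_geometric)
  ultimately show "\<exists>d>0. cball x d \<subseteq> ball 0 (2 ^ K) \<and>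
      uniform_limit (cball x d) (\<lambda>n z. \<Sum>k<n. bump (k + K) z) (\<lambda>z. \<Sum>k. bump (k + K) z) sequentially"
    by blast
qed auto

lemma ex_power2_gt: "\<exists>K. cmod z < 2 ^ K"
  by (rule real_arch_pow) simp

lemma summable_bump: "summable (\<lambda>k. bump k z)"
proof -
  obtain K where K: "cmod z < 2 ^ K" using ex_power2_gt by blast
  have le: "norm (bump k z) \<le> (1/2) ^ k" if "k \<ge> K" for k
  proof -
    have "cmod (bump k z) \<le> (1/2) ^ (k + 3)"
      by (rule bump_small'[of z K]) (use K that in auto)
    also have "\<dots> \<le> (1/2) ^ k" by (rule power_decreasing) auto
    finally show ?thesis .
  qed
  have "summable (\<lambda>k. (1/2) ^ k :: real)" by (simp add: summable_geometric)
  then show ?thesis using le by (rule summable_comparison_test')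
qed

lemma bumps_split: "bumps z = (\<Sum>k<K. bump k z) + (\<Sum>k. bump (k + K) z)"
  unfolding bumps_def
  by (rule trans[OF suminf_split_initial_segment[OF summable_bump[of z], of K] add.commute])

text \<open>Near a given point only finitely many rational terms can have poles; the remaining tail
  is holomorphic.\<close>

lemma bumps_meromorphic: "bumps meromorphic_on UNIV"
proof (subst meromorphic_on_meromorphic_at, safe)
  fix z
  obtain K where K: "cmod z < 2 ^ K" using ex_power2_gt by blast
  have "(\<lambda>z. \<Sum>k. bump (k + K) z) analytic_on {z}"
    using bumps_tail_holomorphic K holomorphic_on_imp_analytic_at by force
  then have "(\<lambda>z. (\<Sum>k<K. bump k z) + (\<Sum>k. bump (k + K) z)) meromorphic_on {z}"
    unfolding bump_def by (intro meromorphic_intros circ_step_meromorphic analytic_on_imp_meromorphic_on)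
  then show "bumps meromorphic_on {z}" by (subst ext[of bumps, OF bumps_split[of _ K]])
qed

lemma sq_map_meromorphic: "sq_map nicely_meromorphic_on UNIV"
  unfolding sq_map_def by (rule remove_sings_nicely_meromorphic[OF bumps_meromorphic])

lemma bumps_analytic:
  assumes "\<And>k. cmod z \<noteq> 2 ^ inner_exp k" "\<And>k. cmod z \<noteq> 2 ^ outer_exp k"
  shows "bumps analytic_on {z}"
proof -
  obtain K where K: "cmod z < 2 ^ K" using ex_power2_gt by blast
  have "(\<lambda>z. \<Sum>k. bump (k + K) z) analytic_on {z}"
    using bumps_tail_holomorphic K holomorphic_on_imp_analytic_at by force
  then have "(\<lambda>z. (\<Sum>k<K. bump k z) + (\<Sum>k. bump (k + K) z)) analytic_on {z}"
    unfolding bump_def using assms by (intro analytic_intros circ_step_analytic)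
  then show ?thesis by (subst ext[of bumps, OF bumps_split[of _ K]])
qed

lemma off_circle_neq: "off_circle m z \<Longrightarrow> cmod z \<noteq> 2 ^ m"
  unfolding off_circle_def by (auto simp: not_le)

definition regular :: "complex \<Rightarrow> bool" where
  "regular z \<longleftrightarrow> (\<forall>k. off_circle (inner_exp k) z \<and> off_circle (outer_exp k) z)"

lemma sq_map_analytic:
  assumes "regular z" shows "sq_map analytic_on {z}"
  unfolding sq_map_def using assms
  by (intro remove_sings_analytic_on bumps_analytic off_circle_neq) (auto simp: regular_def)

lemma sq_map_eq:
  assumes "regular z" shows "sq_map z = bumps z"
  unfolding sq_map_def using assms
  by (intro remove_sings_at_analytic bumps_analytic off_circle_neq) (auto simp: regular_def)

lemma sq_map_minus: "regular z \<Longrightarrow> sq_map (- z) = sq_map z"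
proof -
  assume z: "regular z"
  moreover from z have "regular (- z)" by (simp add: regular_def off_circle_def)
  ultimately show ?thesis by (simp add: sq_map_eq bumps_def bump_def circ_step_minus)
qed

section \<open>Approximation by \<open>z\<^sup>2\<close> and by 0\<close>

definition beyond :: "nat \<Rightarrow> complex \<Rightarrow> complex" where
  "beyond m z = (if 2 ^ m < cmod z then 1 else 0)"

lemma circ_step_beyond:
  assumes "off_circle m z"
  shows "cmod (z\<^sup>2 * (circ_step m k z - beyond m z)) \<le> (1/2) ^ (k + 4)"
  using assms unfolding off_circle_def
proof
  assume a: "2 * cmod z \<le> 2 ^ m"
  then have "\<not> 2 ^ m < cmod z" by (smt (verit) norm_ge_zero)
  then show ?thesis using circ_step_small[OF a] by (simp add: beyond_def)
next
  assume a: "2 * 2 ^ m \<le> cmod z"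
  moreover have "(0::real) < 2 ^ m" by simp
  ultimately have "2 ^ m < cmod z" by linarith
  then show ?thesis using circ_step_large[OF a] by (simp add: beyond_def)
qed

text \<open>The two steps of bump \<open>k\<close> contribute an error of at most
  \<open>2 * (1/2) ^ (k + 4)\<close>, and these errors sum to 1/4. The constant \<open>c\<close>
  counts the pairs of circles that have \<open>z\<close> between them.\<close>

lemma sq_map_approx:
  assumes z: "regular z"
    and sums: "(\<lambda>k. beyond (inner_exp k) z - beyond (outer_exp k) z) sums c"
  shows "cmod (sq_map z - c * z\<^sup>2) \<le> 1/4"
proof -
  define e where "e k = bump k z - (beyond (inner_exp k) z - beyond (outer_exp k) z) * z\<^sup>2" for k
  have "(\<lambda>k. bump k z) sums bumps z" unfolding bumps_def using summable_bump by (rule summable_sums)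
  from sums_diff[OF this sums_mult2[OF sums, of "z\<^sup>2"]]
  have e: "e sums (bumps z - c * z\<^sup>2)" by (simp add: e_def[abs_def])
  have le: "norm (e k) \<le> (1/8) * (1/2) ^ k" for k
  proof -
    have "e k = z\<^sup>2 * (circ_step (inner_exp k) k z - beyond (inner_exp k) z)
        - z\<^sup>2 * (circ_step (outer_exp k) k z - beyond (outer_exp k) z)"
      by (simp add: e_def bump_def algebra_simps)
    also have "norm \<dots> \<le> (1/2) ^ (k + 4) + (1/2) ^ (k + 4)"
      by (rule norm_triangle_le_diff[OF add_mono[OF circ_step_beyond circ_step_beyond]])
         (use z in \<open>auto simp: regular_def\<close>)
    also have "\<dots> = (1/8) * (1/2) ^ k" by (simp add: power_add power_numeral_reduce)
    finally show ?thesis .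
  qed
  have "norm (suminf e) \<le> (\<Sum>k. (1/8) * (1/2) ^ k :: real)"
    by (intro norm_suminf_le le) (auto simp: summable_geometric)
  also have "\<dots> = 1/4" by (subst suminf_mult) (auto simp: suminf_geometric summable_geometric)
  finally show ?thesis using sums_unique[OF e] sq_map_eq[OF z] by simp
qed

definition main_ann :: "nat \<Rightarrow> complex set" where
  "main_ann k = {z. 2 ^ (inner_exp k + 1) \<le> cmod z \<and> cmod z \<le> 2 ^ (outer_exp k - 1)}"

definition dead :: "complex set" where
  "dead = {z. 2 * cmod z \<le> 2 ^ inner_exp 0 \<or>
     (\<exists>k. 2 ^ (outer_exp k + 1) \<le> cmod z \<and> cmod z \<le> 2 ^ (inner_exp (Suc k) - 1))}"

lemma off_circleI:
  "cmod z \<le> 2 ^ n \<Longrightarrow> n + 1 \<le> m \<Longrightarrow> off_circle m z"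
  "2 ^ n \<le> cmod z \<Longrightarrow> m + 1 \<le> n \<Longrightarrow> off_circle m z"
  unfolding off_circle_def
  using power_increasing[of "n+1" m "2::real"] power_increasing[of "m+1" n "2::real"] by auto

lemma beyond_simps:
  "cmod z \<le> 2 ^ n \<Longrightarrow> n \<le> m \<Longrightarrow> beyond m z = 0"
  "2 ^ n \<le> cmod z \<Longrightarrow> m + 1 \<le> n \<Longrightarrow> beyond m z = 1"
proof -
  assume "cmod z \<le> 2 ^ n" "n \<le> m"
  then have "\<not> 2 ^ m < cmod z"
    using power_increasing[of n m "2::real"] by linarith
  then show "beyond m z = 0" by (simp add: beyond_def)
next
  assume "2 ^ n \<le> cmod z" "m + 1 \<le> n"
  then have "2 ^ m < cmod z"
    using power_strict_increasing[of m n "2::real"] by linarith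
  then show "beyond m z = 1" by (simp add: beyond_def)
qed

lemma exps_mono: "i \<le> k \<Longrightarrow> inner_exp i \<le> inner_exp k" "i \<le> k \<Longrightarrow> outer_exp i \<le> outer_exp k"
  using power_increasing[of i k "2::nat"] by (auto simp: inner_exp_def outer_exp_def intro!: diff_le_mono)

lemma main_ann_props:
  assumes "z \<in> main_ann k"
  shows main_ann_regular: "regular z" and main_ann_approx: "cmod (sq_map z - z\<^sup>2) \<le> 1/4"
proof -
  from assms have z: "2 ^ (inner_exp k + 1) \<le> cmod z" "cmod z \<le> 2 ^ (outer_exp k - 1)"
    by (auto simp: main_ann_def)
  have i: "inner_exp j \<le> inner_exp k \<and> (j \<noteq> k \<longrightarrow> outer_exp j + 2 \<le> inner_exp k)" if "j \<le> k" for j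
    using that exps_mono[of j k] exps_less(2)[where i = j and k = k] by auto
  have o: "outer_exp k \<le> outer_exp j \<and> (j \<noteq> k \<longrightarrow> outer_exp k + 2 \<le> inner_exp j)" if "k \<le> j" for j
    using that exps_mono[of k j] exps_less(2)[where i = k and k = j] by auto
  have pos: "outer_exp k \<ge> 1" by (simp add: outer_exp_def)
  show reg: "regular z" unfolding regular_def
  proof
    fix j
    consider "j < k" | "j = k" | "j > k" by linarith
    then show "off_circle (inner_exp j) z \<and> off_circle (outer_exp j) z"
    proof cases
      case 1 then show ?thesis using i[of j] off_circleI(2)[OF z(1)] by auto
    next
      case 2 then show ?thesis using off_circleI(2)[OF z(1)] off_circleI(1)[OF z(2)] pos by auto
    next
      case 3 then show ?thesis using o[of j] off_circleI(1)[OF z(2)] pos by auto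
    qed
  qed
  \<comment> \<open>Below index \<open>k\<close> both indicators are 1, above it both are 0; only
    the pair at \<open>k\<close> leaves a difference.\<close>
  have "beyond (inner_exp j) z - beyond (outer_exp j) z = (if j = k then 1 else 0)" for j
  proof -
    consider "j < k" | "j = k" | "j > k" by linarith
    then show ?thesis
    proof cases
      case 1 then show ?thesis using i[of j] beyond_simps(2)[OF z(1)] by auto
    next
      case 2 then show ?thesis using beyond_simps(2)[OF z(1)] beyond_simps(1)[OF z(2)] pos by auto
    next
      case 3 then show ?thesis using o[of j] beyond_simps(1)[OF z(2)] by auto
    qed
  qed
  then have "(\<lambda>j. beyond (inner_exp j) z - beyond (outer_exp j) z) sums 1"
    using sums_single[of k "\<lambda>_. 1::complex"] by simp
  from sq_map_approx[OF reg this] show "cmod (sq_map z - z\<^sup>2) \<le> 1/4" by simp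
qed

lemma dead_props:
  assumes "z \<in> dead"
  shows dead_regular: "regular z" and dead_bound: "cmod (sq_map z) \<le> 1/4"
proof -
  \<comment> \<open>A dead point never lies between the two circles of one pair, so the indicators
    of each pair agree.\<close>
  have *: "regular z \<and> (\<forall>j. beyond (inner_exp j) z - beyond (outer_exp j) z = 0)"
    using assms unfolding dead_def mem_Collect_eq
  proof
    assume z: "2 * cmod z \<le> 2 ^ inner_exp 0"
    have "(2::real) ^ inner_exp 0 = 2 * 2 ^ (inner_exp 0 - 1)"
      by (simp add: inner_exp_def)
    with z have z: "cmod z \<le> 2 ^ (inner_exp 0 - 1)" by simp
    have o: "inner_exp 0 \<le> inner_exp j" "inner_exp 0 \<le> outer_exp j" for j
      using exps_mono[of 0 j] exps_less(1)[of j] by auto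
    have pos: "inner_exp 0 \<ge> 1" by (simp add: inner_exp_def)
    then show ?thesis unfolding regular_def
      using o off_circleI(1)[OF z] beyond_simps(1)[OF z]
      by (metis (no_types, lifting) diff_self le_add_diff_inverse2 le_trans diff_le_self)
  next
    assume "\<exists>k. 2 ^ (outer_exp k + 1) \<le> cmod z \<and> cmod z \<le> 2 ^ (inner_exp (Suc k) - 1)"
    then obtain k where z: "2 ^ (outer_exp k + 1) \<le> cmod z" "cmod z \<le> 2 ^ (inner_exp (Suc k) - 1)"
      by blast
    have pos: "inner_exp (Suc k) \<ge> 1" using less_inner_exp(1)[of "Suc k"] by linarith
    have i: "inner_exp j \<le> outer_exp k \<and> outer_exp j \<le> outer_exp k" if "j \<le> k" for j
      using exps_mono[of j k] exps_less(1)[of j] that by auto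
    have o: "inner_exp (Suc k) \<le> inner_exp j \<and> inner_exp (Suc k) \<le> outer_exp j" if "\<not> j \<le> k" for j
      using exps_mono[of "Suc k" j] exps_less(1)[of j] that by auto
    have "off_circle (inner_exp j) z \<and> off_circle (outer_exp j) z \<and>
        beyond (inner_exp j) z - beyond (outer_exp j) z = 0" for j
    proof (cases "j \<le> k")
      case True
      then show ?thesis using i[OF True] off_circleI(2)[OF z(1)] beyond_simps(2)[OF z(1)] by auto
    next
      case False
      then show ?thesis using o[OF False] off_circleI(1)[OF z(2)] beyond_simps(1)[OF z(2)] pos by auto
    qed
    then show ?thesis by (auto simp: regular_def)
  qed
  then show reg: "regular z" by simp
  have "(\<lambda>j. beyond (inner_exp j) z - beyond (outer_exp j) z) sums 0" using * by simp
  from sq_map_approx[OF reg this] show "cmod (sq_map z) \<le> 1/4" by simp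
qed

section \<open>The sphere\<close>

lemma dist_Fin_Infinity: "dist (Fin z) Infinity = 2 / sqrt (1 + (cmod z)\<^sup>2)"
proof -
  define c where "c = 1 + (cmod z)\<^sup>2"
  have c: "c > 0" unfolding c_def by (simp add: add_pos_nonneg)
  have "dist (Fin z) Infinity = norm ((2 / c) *\<^sub>R z, - 2 / c)"
    using snd_stereo_Fin[of z] by (simp add: dist_rsphere_def dist_norm c_def)
  also have "\<dots> = sqrt ((2 / c)\<^sup>2 * (cmod z)\<^sup>2 + (2 / c)\<^sup>2)"
    by (simp add: norm_Pair power_mult_distrib power_divide)
  also have "(2 / c)\<^sup>2 * (cmod z)\<^sup>2 + (2 / c)\<^sup>2 = (2 / c)\<^sup>2 * c"
    by (simp add: c_def algebra_simps)
  also have "\<dots> = 2\<^sup>2 / c" using c by (simp add: power2_eq_square)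
  finally show ?thesis by (simp add: real_sqrt_divide c_def)
qed

lemma dist_Infinity_le:
  assumes "c \<le> cmod z" "c > 0"
  shows "dist (Fin z) Infinity \<le> 2 / c"
proof -
  have "c\<^sup>2 \<le> (cmod z)\<^sup>2" using assms by (intro power_mono) auto
  then have "c\<^sup>2 \<le> 1 + (cmod z)\<^sup>2" by linarith
  then have "c \<le> sqrt (1 + (cmod z)\<^sup>2)" by (rule real_le_rsqrt)
  then show ?thesis unfolding dist_Fin_Infinity using assms by (intro frac_le) auto
qed

text \<open>Together with \<open>dist_Infinity_le\<close> this separates orbits ending in the unit
  disc from orbits near \<open>Infinity\<close>.\<close>

lemma dist_Infinity_ge:
  assumes "cmod z \<le> 1"
  shows "dist (Fin z) Infinity \<ge> 1"
proof -
  have "(cmod z)\<^sup>2 \<le> 1" using assms by (simp add: power_le_one)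
  then have "sqrt (1 + (cmod z)\<^sup>2) \<le> 2" by (intro real_le_lsqrt) auto
  moreover have "sqrt (1 + (cmod z)\<^sup>2) > 0" by (simp add: add_pos_nonneg)
  ultimately show ?thesis by (simp add: dist_Fin_Infinity)
qed

lemma continuous_on_stereo: "continuous_on A stereo"
  unfolding continuous_on_iff dist_rsphere_def by auto

lemma continuous_on_Fin: "continuous_on A Fin"
proof -
  have "1 + (cmod z)\<^sup>2 \<noteq> 0" "(cmod z)\<^sup>2 + 1 \<noteq> 0" for z
    using zero_le_power2[of "cmod z"] by linarith+
  then have "continuous_on A (\<lambda>z. stereo (Fin z))"
    by (auto intro!: continuous_intros)
  then show ?thesis unfolding continuous_on_iff dist_rsphere_def .
qed

text \<open>Stereographic projection from the north pole inverts \<open>stereo\<close>; the formula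
  yields the continuity of \<open>fin_part\<close> off \<open>Infinity\<close>.\<close>

lemma fin_part_stereo:
  "y \<noteq> Infinity \<Longrightarrow> fin_part y = fst (stereo y) /\<^sub>R (1 - snd (stereo y))"
proof (cases y)
  case (Fin z)
  have "1 + (cmod z)\<^sup>2 \<noteq> 0" using zero_le_power2[of "cmod z"] by linarith
  then have "inverse (2 / (1 + (cmod z)\<^sup>2)) * (2 / (1 + (cmod z)\<^sup>2)) = 1"
    by (intro left_inverse) simp
  moreover have "1 - snd (stereo (Fin z)) = 2 / (1 + (cmod z)\<^sup>2)" using snd_stereo_Fin[of z] by simp
  moreover have "fst (stereo (Fin z)) = (2 / (1 + (cmod z)\<^sup>2)) *\<^sub>R z" by simp
  ultimately show ?thesis unfolding Fin by (simp only: scaleR_scaleR scaleR_one fin_part.simps)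
qed simp

lemma stereo_pole: "y \<noteq> Infinity \<Longrightarrow> snd (stereo y) \<noteq> 1"
proof (cases y)
  case (Fin z)
  have "1 + (cmod z)\<^sup>2 \<noteq> 0" using zero_le_power2[of "cmod z"] by linarith
  then show ?thesis unfolding Fin snd_stereo_Fin by simp
qed simp

lemma continuous_on_fin_part: "continuous_on (- {Infinity}) fin_part"
proof -
  have "continuous_on (- {Infinity}) (\<lambda>y. fst (stereo y) /\<^sub>R (1 - snd (stereo y)))"
    using stereo_pole by (auto intro!: continuous_intros continuous_on_stereo)
  then show ?thesis
    by (rule continuous_on_eq) (simp add: fin_part_stereo)
qed

lemma Fin_image_eq: "Fin ` U = fin_part -` U \<inter> - {Infinity}"
proof (rule set_eqI)
  fix y show "y \<in> Fin ` U \<longleftrightarrow> y \<in> fin_part -` U \<inter> - {Infinity}" by (cases y) auto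
qed

lemma open_Fin_image: "open U \<Longrightarrow> open (Fin ` U)"
  unfolding Fin_image_eq
  using continuous_on_open_vimage[of "- {Infinity}" fin_part] continuous_on_fin_part by (auto simp: open_Compl)

section \<open>Orbits\<close>

lemma partial_iter_regular:
  assumes "\<And>j. j < n \<Longrightarrow> regular ((sq_map ^^ j) z)"
  shows "partial_iter sq_map n (Fin z) = Some (Fin ((sq_map ^^ n) z))"
  using assms
proof (induction n)
  case (Suc n)
  have "\<not> is_pole sq_map ((sq_map ^^ n) z)"
    using analytic_at_imp_no_pole sq_map_analytic Suc.prems by blast
  then show ?case using Suc by (simp add: sphere_eval_def)
qed simp

lemma sphere_iter_regular:
  assumes "\<And>j. regular ((sq_map ^^ j) z)"
  shows "sphere_iter sq_map n (Fin z) = Fin ((sq_map ^^ n) z)"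
  using partial_iter_regular[of n z] assms by (simp add: sphere_iter_def)

lemma funpow_analytic:
  assumes "\<And>j. j < n \<Longrightarrow> regular ((sq_map ^^ j) z)"
  shows "(sq_map ^^ n) analytic_on {z}"
  using assms
proof (induction n)
  case (Suc n)
  then have "(sq_map ^^ n) analytic_on {z}" by simp
  moreover have "sq_map analytic_on (sq_map ^^ n) ` {z}" using Suc.prems sq_map_analytic by simp
  ultimately have "sq_map \<circ> (sq_map ^^ n) analytic_on {z}" by (rule analytic_on_compose)
  then show ?case by (simp only: funpow.simps)
qed (simp add: id_def)

section \<open>The dead zone and the boundary circles\<close>

lemma dead_orbit:
  assumes "z \<in> dead"
  shows "(sq_map ^^ n) z \<in> dead" "cmod ((sq_map ^^ Suc n) z) \<le> 1/4"
proof -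
  have *: "w \<in> dead" if "cmod w \<le> 1/4" for w
    using that by (simp add: dead_def inner_exp_def)
  show 1: "(sq_map ^^ n) z \<in> dead" for n
    by (induction n) (use assms * dead_bound in auto)
  show "cmod ((sq_map ^^ Suc n) z) \<le> 1/4" using dead_bound[OF 1[of n]] by simp
qed

lemma main_ann_ge_2:
  assumes "z \<in> main_ann k" shows "2 \<le> cmod z"
proof -
  have "(2::real) ^ 1 \<le> 2 ^ (inner_exp k + 1)" by (rule power_increasing) auto
  also have "\<dots> \<le> cmod z" using assms by (simp add: main_ann_def)
  finally show ?thesis by simp
qed

text \<open>The error 1/4 is absorbed by a factor 2: a base-2 exponent \<open>e\<close> of the
  modulus turns into one between \<open>2 * e - 1\<close> and \<open>2 * e + 1\<close>.\<close>

lemma sq_map_bounds: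
  assumes "z \<in> main_ann k"
  shows "cmod z \<le> 2 ^ p \<Longrightarrow> cmod (sq_map z) \<le> 2 ^ (2 * p + 1)"
    and "2 ^ Suc p \<le> cmod z \<Longrightarrow> 2 ^ (2 * p + 1) \<le> cmod (sq_map z)"
proof -
  have d: "\<bar>cmod (sq_map z) - (cmod z)\<^sup>2\<bar> \<le> 1/4"
    using main_ann_approx[OF assms] norm_triangle_ineq3[of "sq_map z" "z\<^sup>2"] by (simp add: norm_power)
  have sq: "((2::real) ^ q)\<^sup>2 = 2 ^ (2 * q)" for q by (simp add: power_mult mult.commute[of 2])
  have one: "(1::real) \<le> 2 ^ q" for q by simp
  {
    assume "cmod z \<le> 2 ^ p"
    then have "(cmod z)\<^sup>2 \<le> 2 ^ (2 * p)" using power_mono[of "cmod z" "2 ^ p" 2] by (simp add: sq)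
    moreover have "(2::real) ^ (2 * p + 1) = 2 * 2 ^ (2 * p)" by simp
    ultimately show "cmod (sq_map z) \<le> 2 ^ (2 * p + 1)" using d one[of "2 * p"] by linarith
  next
    assume "2 ^ Suc p \<le> cmod z"
    then have "2 ^ (2 * Suc p) \<le> (cmod z)\<^sup>2" using power_mono[of "2 ^ Suc p" "cmod z" 2] by (simp only: sq) simp
    moreover have "(2::real) ^ (2 * p + 1) = 2 * 2 ^ (2 * p)" "(2::real) ^ (2 * Suc p) = 4 * 2 ^ (2 * p)" by simp_all
    ultimately show "2 ^ (2 * p + 1) \<le> cmod (sq_map z)" using d one[of "2 * p"] by linarith
  }
qed

text \<open>Here the offsets 4 in the exponents are used. The inner boundary circle has an image
  with exponent at most \<open>2 * inner_exp k + 3 = inner_exp (Suc k) - 1\<close>, the outer one an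
  image with exponent at least \<open>2 * outer_exp k - 3 = outer_exp (Suc k) + 1\<close>. The other
  two bounds have room to spare.\<close>

lemma main_ann_frontier:
  assumes "cmod z = 2 ^ (inner_exp k + 1) \<or> cmod z = 2 ^ (outer_exp k - 1)"
  shows "z \<in> main_ann k" "sq_map z \<in> dead"
proof -
  have "(2::real) ^ (inner_exp k + 1) \<le> 2 ^ (outer_exp k - 1)"
    using exps_less(1)[of k] by (intro power_increasing) auto
  then show z: "z \<in> main_ann k" using assms by (auto simp: main_ann_def)
  \<comment> \<open>Writing \<open>2 ^ k\<close> as a successor turns the truncated subtraction in
    \<open>inner_exp\<close> into linear arithmetic.\<close>
  obtain y where y: "(2::nat) ^ k = Suc y" by (metis gr0_implies_Suc zero_less_numeral zero_less_power)
  have e: "outer_exp k = 48 * y + 52" "outer_exp (Suc k) = 96 * y + 100"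
    "inner_exp k = 32 * y + 28" "inner_exp (Suc k) = 64 * y + 60" "inner_exp (Suc (Suc k)) = 128 * y + 124"
    by (auto simp: outer_exp_def inner_exp_def y)
  show "sq_map z \<in> dead"
    using assms
  proof
    assume eq: "cmod z = 2 ^ (inner_exp k + 1)"
    have "cmod (sq_map z) \<le> 2 ^ (2 * (inner_exp k + 1) + 1)"
      by (rule sq_map_bounds[OF z]) (simp add: eq)
    also have "\<dots> \<le> 2 ^ (inner_exp (Suc k) - 1)"
      by (rule power_increasing) (auto simp: e)
    finally have 1: "cmod (sq_map z) \<le> 2 ^ (inner_exp (Suc k) - 1)" .
    have "(2::real) ^ (outer_exp k + 1) \<le> 2 ^ (2 * inner_exp k + 1)"
      by (rule power_increasing) (auto simp: e)
    also have "\<dots> \<le> cmod (sq_map z)"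
      by (rule sq_map_bounds[OF z]) (simp add: eq)
    finally show ?thesis using 1 by (auto simp: dead_def)
  next
    assume eq: "cmod z = 2 ^ (outer_exp k - 1)"
    have "cmod (sq_map z) \<le> 2 ^ (2 * (outer_exp k - 1) + 1)"
      by (rule sq_map_bounds[OF z]) (simp add: eq)
    also have "\<dots> \<le> 2 ^ (inner_exp (Suc (Suc k)) - 1)"
      by (rule power_increasing) (auto simp: e)
    finally have 1: "cmod (sq_map z) \<le> 2 ^ (inner_exp (Suc (Suc k)) - 1)" .
    have "(2::real) ^ (outer_exp (Suc k) + 1) \<le> 2 ^ (2 * (outer_exp k - 2) + 1)"
      by (rule power_increasing) (auto simp: e)
    also have "\<dots> \<le> cmod (sq_map z)"
      by (rule sq_map_bounds[OF z]) (simp add: eq e)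
    finally show ?thesis using 1 unfolding dead_def by blast
  qed
qed

text \<open>The images tell the two apart: a dead point goes into the disc of radius 1/4, a point of
  a main annulus to modulus at least 2.\<close>

lemma dead_not_main_ann: "z \<in> dead \<Longrightarrow> z \<notin> main_ann k"
  using dead_bound[of z] sq_map_bounds(2)[of z k 0] main_ann_ge_2[of z k] by auto

section \<open>Orbits that climb through the annuli\<close>

definition trapped :: "nat \<Rightarrow> complex set" where
  "trapped m = {z. \<forall>n. (sq_map ^^ n) z \<in> main_ann (m + n)}"

lemma trapped_regular: "z \<in> trapped m \<Longrightarrow> regular ((sq_map ^^ n) z)"
  using main_ann_regular by (auto simp: trapped_def)

lemma trapped_funpow: "z \<in> trapped m \<Longrightarrow> (sq_map ^^ n) z \<in> trapped (m + n)"
proof -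
  assume z: "z \<in> trapped m"
  have "(sq_map ^^ j) ((sq_map ^^ n) z) = (sq_map ^^ (n + j)) z" for j
    by (simp add: add.commute[of n] funpow_add)
  with z show ?thesis by (auto simp: trapped_def add.assoc)
qed

lemma trapped_subset_main_ann: "trapped m \<subseteq> main_ann m"
proof
  fix z assume "z \<in> trapped m"
  then have "(sq_map ^^ 0) z \<in> main_ann (m + 0)" unfolding trapped_def by blast
  then show "z \<in> main_ann m" by simp
qed

lemma trapped_large: "z \<in> trapped m \<Longrightarrow> 2 ^ n \<le> cmod ((sq_map ^^ n) z)"
proof -
  assume "z \<in> trapped m"
  then have "2 ^ (inner_exp (m + n) + 1) \<le> cmod ((sq_map ^^ n) z)"
    by (auto simp: trapped_def main_ann_def)
  moreover have "(2::real) ^ n \<le> 2 ^ (inner_exp (m + n) + 1)"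
    using less_inner_exp(1)[of "m + n"] by (intro power_increasing) auto
  ultimately show ?thesis by linarith
qed

lemma trapped_sphere_iter:
  assumes "z \<in> trapped m"
  shows "partial_iter sq_map n (Fin z) = Some (Fin ((sq_map ^^ n) z))"
    "sphere_iter sq_map n (Fin z) = Fin ((sq_map ^^ n) z)"
    "iter sq_map n z = (sq_map ^^ n) z"
  using partial_iter_regular sphere_iter_regular trapped_regular[OF assms]
  by (auto simp: iter_def)

lemma trapped_funpow_analytic: "z \<in> trapped m \<Longrightarrow> (sq_map ^^ n) analytic_on {z}"
  using funpow_analytic trapped_regular by blast

lemma closed_main_ann: "closed (main_ann k)"
  unfolding main_ann_def by (intro closed_Collect_conj closed_Collect_le continuous_intros)

text \<open>Continuity of an iterate is known only where the earlier iterates are regular. Hence the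
  induction over the points that stay in the annuli up to time \<open>n\<close>: on this closed set
  the next iterate is continuous, and the next condition is a closed preimage.\<close>

lemma closed_trapped: "closed (trapped m)"
proof -
  define T where "T n = {z. \<forall>j\<le>n. (sq_map ^^ j) z \<in> main_ann (m + j)}" for n
  have "closed (T n)" for n
  proof (induction n)
    case 0
    have "T 0 = main_ann m" by (auto simp: T_def)
    then show ?case by (simp add: closed_main_ann)
  next
    case (Suc n)
    have "continuous_on (T n) (sq_map ^^ Suc n)"
    proof (intro continuous_at_imp_continuous_on ballI analytic_at_imp_isCont funpow_analytic)
      fix z j assume "z \<in> T n" "j < Suc n"
      then have "(sq_map ^^ j) z \<in> main_ann (m + j)" unfolding T_def by auto
      then show "regular ((sq_map ^^ j) z)" by (rule main_ann_regular)
    qed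
    from continuous_closed_preimage[OF this Suc closed_main_ann]
    have "closed (T n \<inter> (sq_map ^^ Suc n) -` main_ann (m + Suc n))" .
    also have "T n \<inter> (sq_map ^^ Suc n) -` main_ann (m + Suc n) = T (Suc n)"
      by (auto simp: T_def le_Suc_eq)
    finally show ?case .
  qed
  moreover have "trapped m = (\<Inter>n. T n)" by (auto simp: trapped_def T_def)
  ultimately show ?thesis by auto
qed

lemma compact_trapped: "compact (trapped m)"
  unfolding compact_eq_bounded_closed
proof
  have "main_ann m \<subseteq> cball 0 (2 ^ (outer_exp m - 1))" by (auto simp: main_ann_def)
  then show "bounded (trapped m)"
    using trapped_subset_main_ann by (intro bounded_subset[OF bounded_cball]) blast
qed (rule closed_trapped)

text \<open>On a segment from a trapped point to a point that is not trapped, look at the first iterate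
  that leaves the annuli: somewhere on the segment it meets a boundary circle, which is mapped
  into the dead zone.\<close>

lemma dead_orbit_nearby:
  assumes z: "z \<in> trapped m" "z \<notin> interior (trapped m)" and "d > 0"
  obtains y n where "y \<in> ball z d" "\<And>j. regular ((sq_map ^^ j) y)"
    "\<And>j. n \<le> j \<Longrightarrow> cmod ((sq_map ^^ j) y) \<le> 1/4"
proof -
  obtain y0 where y0: "y0 \<in> ball z d" "y0 \<notin> trapped m"
    using z(2) \<open>d > 0\<close> unfolding mem_interior by blast
  define S where "S = closed_segment z y0"
  have S: "S \<subseteq> ball z d" "z \<in> S" "y0 \<in> S" "connected S"
    unfolding S_def using y0 \<open>d > 0\<close> by (auto simp: closed_segment_subset)
  define n where "n = (LEAST n. \<exists>y\<in>S. (sq_map ^^ n) y \<notin> main_ann (m + n))"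
  have ex: "\<exists>n. \<exists>y\<in>S. (sq_map ^^ n) y \<notin> main_ann (m + n)"
    using y0 S(3) by (auto simp: trapped_def)
  obtain y where y: "y \<in> S" "(sq_map ^^ n) y \<notin> main_ann (m + n)"
    using LeastI_ex[OF ex] unfolding n_def by blast
  have less: "(sq_map ^^ j) x \<in> main_ann (m + j)" if "j < n" "x \<in> S" for j x
    using not_less_Least[of j] that unfolding n_def by blast
  define g where "g x = cmod ((sq_map ^^ n) x)" for x
  have "continuous_on S (sq_map ^^ n)"
    by (intro continuous_at_imp_continuous_on ballI analytic_at_imp_isCont funpow_analytic
        main_ann_regular[OF less])
  then have "connected (g ` S)" unfolding g_def
    by (intro connected_continuous_image S(4) continuous_intros)
  note ivt = connectedD_interval[OF this]
  have gz: "2 ^ (inner_exp (m + n) + 1) \<le> g z" "g z \<le> 2 ^ (outer_exp (m + n) - 1)"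
    using z(1) by (auto simp: trapped_def main_ann_def g_def)
  have "2 ^ (inner_exp (m + n) + 1) \<in> g ` S \<or> 2 ^ (outer_exp (m + n) - 1) \<in> g ` S"
  proof (cases "g y < 2 ^ (inner_exp (m + n) + 1)")
    case True
    then show ?thesis using ivt[of "g y" "g z"] gz y(1) S(2) by auto
  next
    case False
    then have "g y > 2 ^ (outer_exp (m + n) - 1)" using y(2) by (auto simp: main_ann_def g_def)
    then show ?thesis using ivt[of "g z" "g y"] gz y(1) S(2) by auto
  qed
  then obtain x where x: "x \<in> S" "cmod ((sq_map ^^ n) x) = 2 ^ (inner_exp (m + n) + 1)
      \<or> cmod ((sq_map ^^ n) x) = 2 ^ (outer_exp (m + n) - 1)"
    unfolding g_def by auto
  note fr = main_ann_frontier[OF x(2)]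
  have orb: "(sq_map ^^ (Suc n + i)) x = (sq_map ^^ i) (sq_map ((sq_map ^^ n) x))" for i
    by (simp add: add.commute[of n] funpow_add funpow_swap1)
  have "regular ((sq_map ^^ j) x)" for j
  proof (cases "j \<le> n")
    case True
    then have "(sq_map ^^ j) x \<in> main_ann (m + j)"
      using less[OF _ x(1), of j] fr(1) by (cases "j = n") auto
    then show ?thesis by (rule main_ann_regular)
  next
    case False
    then have "j = Suc n + (j - Suc n)" by simp
    then show ?thesis using orb[of "j - Suc n"] dead_regular[OF dead_orbit(1)[OF fr(2)]] by metis
  qed
  \<comment> \<open>The image of the boundary circle is dead but still large; the small values start
    one step later.\<close>
  moreover have "cmod ((sq_map ^^ j) x) \<le> 1/4" if "Suc (Suc n) \<le> j" for j
  proof -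
    have "j = Suc n + Suc (j - Suc (Suc n))" using that by simp
    then show ?thesis using orb[of "Suc (j - Suc (Suc n))"] dead_orbit(2)[OF fr(2)] by metis
  qed
  ultimately show thesis using that x(1) S(1) by blast
qed

text \<open>Let a subsequence of the iterates converge uniformly near \<open>z\<close> to
  \<open>l\<close>. One of its members, at time \<open>N\<close>, maps points near \<open>z\<close>
  close to \<open>Infinity\<close>, but some such point \<open>y\<close> has an orbit that ends in
  the unit disc. Its iterates at time \<open>N\<close> and at a suitable time \<open>M\<close> are
  both within 1/4 of \<open>l (Fin y)\<close>, although their chordal distances to
  \<open>Infinity\<close> are at most 1/8 and at least 1.\<close>

lemma Fatou_trapped_interior:
  assumes z: "z \<in> trapped m" and F: "Fin z \<in> Fatou_set sq_map"
  shows "z \<in> interior (trapped m)"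
proof (rule ccontr)
  assume notin: "z \<notin> interior (trapped m)"
  obtain V where V: "open V" "Fin z \<in> V" "normal_family_on (range (sphere_iter sq_map)) V"
    using F by (auto simp: Fatou_set_def)
  have "open (Fin -` V)" using open_vimage[OF V(1) continuous_on_Fin] .
  then obtain d where d: "d > 0" "cball z d \<subseteq> Fin -` V"
    using V(2) open_contains_cball by blast
  define K where "K = Fin ` cball z d"
  have "compact K" unfolding K_def by (intro compact_continuous_image continuous_on_Fin compact_cball)
  moreover have "K \<subseteq> V" using d(2) by (auto simp: K_def)
  moreover obtain k l where k: "strict_mono k"
      "loc_uniform_limit V (sphere_iter sq_map \<circ> k) l"
    using V(3) unfolding normal_family_on_def by blast
  ultimately have "uniform_limit K (sphere_iter sq_map \<circ> k) l sequentially"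
    by (auto simp: loc_uniform_limit_def)
  then have "\<forall>\<^sub>F i in sequentially. \<forall>x\<in>K. dist (sphere_iter sq_map (k i) x) (l x) < 1/4"
    unfolding uniform_limit_iff by (auto dest!: spec[of _ "1/4"])
  then obtain i0 where i0: "\<And>i x. i \<ge> i0 \<Longrightarrow> x \<in> K \<Longrightarrow> dist (sphere_iter sq_map (k i) x) (l x) < 1/4"
    unfolding eventually_sequentially by blast
  \<comment> \<open>A time of at least 5 makes the modulus at \<open>z\<close> at least 32, so it
    exceeds 16 nearby and the chordal distance to \<open>Infinity\<close> is at most 1/8
    there.\<close>
  define N where "N = k (max i0 5)"
  have "5 \<le> N" using seq_suble[OF k(1), of "max i0 5"] by (simp add: N_def)
  then have "(2::real) ^ 5 \<le> 2 ^ N" by (intro power_increasing) auto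
  with trapped_large[OF z, of N] have "cmod ((sq_map ^^ N) z) > 16" by simp
  moreover define g where "g x = cmod ((sq_map ^^ N) x)" for x
  have "isCont g z" unfolding g_def
    by (intro continuous_intros analytic_at_imp_isCont trapped_funpow_analytic[OF z])
  then have "(g \<longlongrightarrow> g z) (nhds z)" by (simp add: isCont_def tendsto_at_iff_tendsto_nhds)
  ultimately have "\<forall>\<^sub>F x in nhds z. cmod ((sq_map ^^ N) x) > 16"
    unfolding g_def by (intro order_tendstoD(1))
  then obtain e where e: "e > 0" "\<And>x. dist x z < e \<Longrightarrow> cmod ((sq_map ^^ N) x) > 16"
    unfolding eventually_nhds_metric by blast
  obtain y n where y: "y \<in> ball z (min d e)" "\<And>j. regular ((sq_map ^^ j) y)"
      "\<And>j. n \<le> j \<Longrightarrow> cmod ((sq_map ^^ j) y) \<le> 1/4"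
    using dead_orbit_nearby[OF z notin, of "min d e"] d(1) e(1) by (metis min_less_iff_conj)
  have yK: "Fin y \<in> K" using y(1) by (auto simp: K_def)
  note it = sphere_iter_regular[OF y(2)]
  define M where "M = k (max i0 n)"
  have "n \<le> M" using seq_suble[OF k(1), of "max i0 n"] by (simp add: M_def)
  then have "dist (Fin ((sq_map ^^ M) y)) Infinity \<ge> 1"
    using y(3)[of M] by (intro dist_Infinity_ge) simp
  moreover have "dist (Fin ((sq_map ^^ M) y)) (l (Fin y)) < 1/4"
    using i0[OF _ yK, of "max i0 n"] by (simp add: it M_def)
  moreover have "dist (Fin ((sq_map ^^ N) y)) (l (Fin y)) < 1/4"
    using i0[OF _ yK, of "max i0 5"] by (simp add: it N_def)
  moreover have "dist (Fin ((sq_map ^^ N) y)) Infinity \<le> 2 / 16"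
    using e(2)[of y] y(1) by (intro dist_Infinity_le) (auto simp: dist_commute)
  ultimately show False
    using dist_triangle[of "Fin ((sq_map ^^ M) y)" Infinity "l (Fin y)"]
      dist_triangle3[of "l (Fin y)" Infinity "Fin ((sq_map ^^ N) y)"] by linarith
qed

text \<open>A sequence in the family of iterates may repeat members and list them in any order.
  Either one index recurs infinitely often, and a constant subsequence converges, or the indices
  tend to infinity.\<close>

lemma nat_seq_subseq:
  fixes s :: "nat \<Rightarrow> nat"
  shows "(\<exists>(k :: nat \<Rightarrow> nat) c. strict_mono k \<and> (\<forall>i. s (k i) = c)) \<or> filterlim s at_top sequentially"
proof (cases "filterlim s at_top sequentially")
  case False
  then obtain B where "\<not> (\<forall>\<^sub>F i in sequentially. B \<le> s i)"
    unfolding filterlim_at_top by blast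
  then have "frequently (\<lambda>i. s i < B) sequentially" by (simp add: frequently_def not_less)
  then have inf: "infinite {i. s i < B}" by (simp add: frequently_cofinite cofinite_eq_sequentially[symmetric])
  have "finite (s ` {i. s i < B})" by (rule finite_subset[of _ "{..<B}"]) auto
  from pigeonhole_infinite[OF inf this] obtain i0 where "infinite {i \<in> {i. s i < B}. s i = s i0}" by blast
  moreover have "{i \<in> {i. s i < B}. s i = s i0} \<subseteq> {i. s i = s i0}" by blast
  ultimately have inf: "infinite {i. s i = s i0}" using infinite_super by blast
  have "strict_mono (enumerate {i. s i = s i0})" using inf by (rule strict_mono_enumerate)
  moreover have "s (enumerate {i. s i = s i0} i) = s i0" for i using enumerate_in_set[OF inf, of i] by simp
  ultimately show ?thesis by blast
qed simp

lemma trapped_dist_Infinity: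
  assumes "x \<in> Fin ` trapped m"
  shows "dist (sphere_iter sq_map n x) Infinity \<le> 2 / 2 ^ n"
  using assms by (auto simp: trapped_sphere_iter(2) intro!: dist_Infinity_le trapped_large)

lemma trapped_uniform_limit:
  assumes "filterlim s at_top sequentially" "S \<subseteq> Fin ` trapped m"
  shows "uniform_limit S (\<lambda>i. sphere_iter sq_map (s i)) (\<lambda>_. Infinity) sequentially"
  unfolding uniform_limit_iff
proof safe
  fix e :: real assume "e > 0"
  have "(\<lambda>n. 2 * (1/2) ^ n) \<longlonglongrightarrow> 2 * (0::real)" by (intro tendsto_intros LIMSEQ_realpow_zero) auto
  then have "\<forall>\<^sub>F n in sequentially. 2 * (1/2) ^ n < e"
    using order_tendstoD(2) \<open>e > 0\<close> by fastforce
  then have "\<forall>\<^sub>F i in sequentially. 2 * (1/2) ^ s i < e"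
    using assms(1) by (rule eventually_compose_filterlim)
  then show "\<forall>\<^sub>F i in sequentially. \<forall>x\<in>S. dist (sphere_iter sq_map (s i) x) Infinity < e"
  proof eventually_elim
    case (elim i)
    show ?case
    proof
      fix x assume "x \<in> S"
      then have "dist (sphere_iter sq_map (s i) x) Infinity \<le> 2 / 2 ^ s i"
        using assms(2) trapped_dist_Infinity by blast
      then show "dist (sphere_iter sq_map (s i) x) Infinity < e"
        using elim by (simp add: power_divide)
    qed
  qed
qed

lemma interior_trapped_Fatou:
  assumes "z \<in> interior (trapped m)"
  shows "Fin z \<in> Fatou_set sq_map"
proof -
  define V where "V = Fin ` interior (trapped m)"
  have sub: "V \<subseteq> Fin ` trapped m" unfolding V_def using interior_subset by blast
  have "normal_family_on (range (sphere_iter sq_map)) V"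
    unfolding normal_family_on_def
  proof safe
    fix g :: "nat \<Rightarrow> rsphere \<Rightarrow> rsphere" assume "range g \<subseteq> range (sphere_iter sq_map)"
    then have "\<forall>i. \<exists>n. g i = sphere_iter sq_map n" by blast
    then obtain s where s: "\<And>i. g i = sphere_iter sq_map (s i)" by metis
    show "\<exists>k l. strict_mono k \<and> loc_uniform_limit V (g \<circ> k) l"
      using nat_seq_subseq[of s]
    proof (elim disjE exE)
      fix k :: "nat \<Rightarrow> nat" and c assume 1: "strict_mono k \<and> (\<forall>i. s (k i) = c)"
      then have "loc_uniform_limit V (g \<circ> k) (sphere_iter sq_map c)"
        by (auto simp: loc_uniform_limit_def uniform_limit_iff s)
      with 1 show ?thesis by blast
    next
      assume 2: "filterlim s at_top sequentially"
      then have "loc_uniform_limit V (g \<circ> id) (\<lambda>_. Infinity)"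
        unfolding loc_uniform_limit_def comp_def id_def s
        using trapped_uniform_limit[OF 2] sub by (blast intro: order_trans)
      then show ?thesis using strict_mono_id by blast
    qed
  qed
  moreover have "partial_iter sq_map n y \<noteq> None" if "y \<in> V" for n y
  proof -
    obtain w where "y = Fin w" "w \<in> trapped m" using \<open>y \<in> V\<close> sub by blast
    then show ?thesis using trapped_sphere_iter(1)[of w m n] by simp
  qed
  moreover have "open V" "Fin z \<in> V" using assms by (auto simp: V_def open_Fin_image)
  ultimately show ?thesis unfolding Fatou_set_def by blast
qed

text \<open>The interior of the trapped set and the complement of the compact trapped set are
  disjoint open sets that cover the Fatou set, by \<open>Fatou_trapped_interior\<close>. A connected
  subset of the Fatou set that meets the interior therefore stays in it.\<close>

lemma Fatou_component_trapped:
  assumes p: "p \<in> interior (trapped m)"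
  shows "Fatou_component sq_map (Fin ` connected_component_set (interior (trapped m)) p)"
  unfolding Fatou_component_def in_components_maximal
proof (intro conjI allI impI)
  let ?I = "interior (trapped m)"
  let ?U = "connected_component_set ?I p"
  have pU: "p \<in> ?U" using p by simp
  have UI: "?U \<subseteq> ?I" by (rule connected_component_subset)
  show "Fin ` ?U \<noteq> {}" using pU by blast
  show "Fin ` ?U \<subseteq> Fatou_set sq_map" using UI interior_trapped_Fatou by blast
  show "connected (Fin ` ?U)"
    by (intro connected_continuous_image continuous_on_Fin connected_connected_component)
  fix D assume "D \<noteq> {} \<and> Fin ` ?U \<subseteq> D \<and> D \<subseteq> Fatou_set sq_map \<and> connected D"
  then have D: "Fin ` ?U \<subseteq> D" "D \<subseteq> Fatou_set sq_map" "connected D" by auto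
  have "closed (Fin ` trapped m)"
    by (intro compact_imp_closed compact_continuous_image continuous_on_Fin compact_trapped)
  then have "open (- (Fin ` trapped m))" by (simp add: open_Compl)
  moreover have "D \<subseteq> Fin ` ?I \<union> - (Fin ` trapped m)"
    using D(2) Fatou_trapped_interior by blast
  moreover have "Fin ` ?I \<inter> - (Fin ` trapped m) \<inter> D = {}" using interior_subset by blast
  moreover have "Fin ` ?I \<inter> D \<noteq> {}" using D(1) pU p by blast
  ultimately have "D \<inter> - (Fin ` trapped m) = {}"
    using connectedD[OF D(3), of "Fin ` ?I" "- (Fin ` trapped m)"] open_Fin_image[OF open_interior]
    by blast
  with \<open>D \<subseteq> Fin ` ?I \<union> - (Fin ` trapped m)\<close> have DI: "D \<subseteq> Fin ` ?I" by blast
  have "connected (fin_part ` D)"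
    using DI by (intro connected_continuous_image D(3) continuous_on_subset[OF continuous_on_fin_part]) auto
  moreover have "p \<in> fin_part ` D" using D(1) pU by force
  moreover have "fin_part ` D \<subseteq> ?I" using DI by auto
  ultimately have "fin_part ` D \<subseteq> ?U" by (intro connected_component_maximal)
  moreover have "y = Fin (fin_part y)" if "y \<in> D" for y using DI that by auto
  ultimately have "D \<subseteq> Fin ` ?U" by (metis image_eqI image_subset_iff subsetI)
  then show "D = Fin ` ?U" using D(1) by blast
qed

section \<open>Openness and the wandering property\<close>

definition open_ann :: "nat \<Rightarrow> complex set" where
  "open_ann k = {z. 2 ^ (inner_exp k + 1) < cmod z \<and> cmod z < 2 ^ (outer_exp k - 1)}"

lemma open_ann_subset: "open_ann k \<subseteq> main_ann k"
  by (auto simp: open_ann_def main_ann_def)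

text \<open>A trapped point on a boundary circle would have a dead image, hence one outside the next
  annulus.\<close>

lemma trapped_subset_open_ann: "trapped m \<subseteq> open_ann m"
proof
  fix z assume z: "z \<in> trapped m"
  then have "(sq_map ^^ 1) z \<in> main_ann (m + 1)" unfolding trapped_def by blast
  then have "sq_map z \<notin> dead" using dead_not_main_ann by auto
  moreover have "z \<in> main_ann m" using z trapped_subset_main_ann by blast
  ultimately show "z \<in> open_ann m"
    using main_ann_frontier(2)[of z m] unfolding main_ann_def open_ann_def mem_Collect_eq by linarith
qed

lemma open_sq_map_image:
  assumes "open U" "U \<subseteq> open_ann k" shows "open (sq_map ` U)"
proof (rule open_mapping_thm[of _ "open_ann k"])
  show "sq_map holomorphic_on open_ann k"
  proof (rule analytic_imp_holomorphic, subst analytic_on_analytic_at, rule ballI)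
    fix z assume "z \<in> open_ann k"
    then show "sq_map analytic_on {z}"
      using sq_map_analytic main_ann_regular open_ann_subset by blast
  qed
  show "open (open_ann k)"
    unfolding open_ann_def by (intro open_Collect_conj open_Collect_less continuous_intros)
  show "connected (open_ann k)"
    using connected_annulus(1)[of "2 ^ (inner_exp k + 1)" "0::complex" "2 ^ (outer_exp k - 1)"]
    by (simp add: open_ann_def)
  show "\<not> sq_map constant_on open_ann k"
  proof
    assume "sq_map constant_on open_ann k"
    then obtain c where c: "\<And>z. z \<in> open_ann k \<Longrightarrow> sq_map z = c" by (auto simp: constant_on_def)
    \<comment> \<open>The radii compared below differ by a factor 4; for a factor 2 the dyadic
      bounds on the images would still touch.\<close>
    define z where "z j = complex_of_real (2 ^ (inner_exp k + j))" for j
    have "inner_exp k + 4 < outer_exp k - 1"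
      using inner_exp_add[of k] one_le_power[of "2::nat" k] by (simp add: outer_exp_def)
    then have "z j \<in> open_ann k" if "1 < j" "j \<le> 4" for j
      using that power_strict_increasing[of "inner_exp k + 1" "inner_exp k + j" "2::real"]
        power_strict_increasing[of "inner_exp k + j" "outer_exp k - 1" "2::real"]
      by (simp add: z_def open_ann_def norm_power)
    then have z: "z 2 \<in> open_ann k" "z 4 \<in> open_ann k" by auto
    have "cmod (sq_map (z 2)) \<le> 2 ^ (2 * (inner_exp k + 2) + 1)"
      by (rule sq_map_bounds(1)[of _ k]) (use z open_ann_subset in \<open>auto simp: z_def norm_power norm_mult\<close>)
    also have "\<dots> < 2 ^ (2 * (inner_exp k + 3) + 1)" by (intro power_strict_increasing) auto
    also have "\<dots> \<le> cmod (sq_map (z 4))"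
      by (rule sq_map_bounds(2)[of _ k]) (use z open_ann_subset in \<open>auto simp: z_def norm_power norm_mult\<close>)
    finally show False using c z by simp
  qed
qed (use assms in auto)

text \<open>The open mapping property turns the inclusion of trapped sets into one of their
  interiors, so that components are carried into components.\<close>

lemma sq_map_interior_trapped:
  assumes "z \<in> interior (trapped m)" shows "sq_map z \<in> interior (trapped (Suc m))"
proof (rule interiorI)
  show "open (sq_map ` interior (trapped m))"
    using interior_subset trapped_subset_open_ann by (intro open_sq_map_image[of _ m]) blast+
  show "sq_map ` interior (trapped m) \<subseteq> trapped (Suc m)"
    using trapped_funpow[of _ m 1] interior_subset by fastforce
qed (use assms in blast)

lemma funpow_interior_trapped:
  "z \<in> interior (trapped m) \<Longrightarrow> (sq_map ^^ n) z \<in> interior (trapped (m + n))"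
  by (induction n) (auto dest: sq_map_interior_trapped)

lemma main_ann_disjoint:
  assumes "m \<noteq> n" shows "main_ann m \<inter> main_ann n = {}"
proof -
  have *: "main_ann m \<inter> main_ann n = {}" if "m < n" for m n
  proof -
    have "(2::real) ^ (outer_exp m - 1) < 2 ^ (inner_exp n + 1)"
      using exps_less(2)[OF that] by (intro power_strict_increasing) auto
    then show ?thesis by (force simp: main_ann_def)
  qed
  then show ?thesis using assms by (metis Int_commute linorder_neqE_nat)
qed

text \<open>The component of \<open>interior (trapped n)\<close> around the \<open>n\<close>-th
  image of \<open>p\<close> serves as \<open>C n\<close>; these lie in pairwise disjoint
  annuli.\<close>

lemma wandering_trapped:
  assumes p: "p \<in> interior (trapped 0)"
  shows "wandering_domain sq_map (Fin ` connected_component_set (interior (trapped 0)) p)"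
proof -
  let ?W = "connected_component_set (interior (trapped 0)) p"
  define C where "C n = Fin ` connected_component_set (interior (trapped n)) ((sq_map ^^ n) p)" for n
  have int: "(sq_map ^^ n) z \<in> interior (trapped n)" if "z \<in> interior (trapped 0)" for z n
    using funpow_interior_trapped[OF that, of n] by simp
  have W: "?W \<subseteq> interior (trapped 0)" by (rule connected_component_subset)
  have sub: "sphere_iter sq_map n ` Fin ` ?W \<subseteq> C n" for n
  proof -
    have "continuous_on ?W (sq_map ^^ n)"
    proof (intro continuous_at_imp_continuous_on ballI analytic_at_imp_isCont)
      fix z assume "z \<in> ?W"
      then have "z \<in> trapped 0" using W interior_subset by blast
      then show "(sq_map ^^ n) analytic_on {z}" by (rule trapped_funpow_analytic)
    qed
    then have "connected ((sq_map ^^ n) ` ?W)" by (intro connected_continuous_image connected_connected_component)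
    moreover have "(sq_map ^^ n) ` ?W \<subseteq> interior (trapped n)" using W int by blast
    moreover have "(sq_map ^^ n) p \<in> (sq_map ^^ n) ` ?W" using p by (intro imageI) simp
    ultimately have *: "(sq_map ^^ n) ` ?W \<subseteq> connected_component_set (interior (trapped n)) ((sq_map ^^ n) p)"
      by (intro connected_component_maximal)
    show ?thesis
    proof (rule image_subsetI)
      fix y assume "y \<in> Fin ` ?W"
      then obtain z where z: "z \<in> ?W" "y = Fin z" by blast
      then have "z \<in> trapped 0" using W interior_subset by blast
      then have "sphere_iter sq_map n y = Fin ((sq_map ^^ n) z)" unfolding z(2) by (rule trapped_sphere_iter(2))
      then show "sphere_iter sq_map n y \<in> C n" using * z(1) unfolding C_def by blast
    qed
  qed
  have comp: "Fatou_component sq_map (C n)" for n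
    unfolding C_def by (intro Fatou_component_trapped int p)
  have C: "C j \<subseteq> Fin ` main_ann j" "C j \<noteq> {}" for j
  proof -
    have "connected_component_set (interior (trapped j)) ((sq_map ^^ j) p) \<subseteq> main_ann j"
      by (rule order_trans[OF connected_component_subset order_trans[OF interior_subset trapped_subset_main_ann]])
    then show "C j \<subseteq> Fin ` main_ann j" unfolding C_def by (rule image_mono)
    have "(sq_map ^^ j) p \<in> connected_component_set (interior (trapped j)) ((sq_map ^^ j) p)"
      using int[OF p, of j] by simp
    then show "C j \<noteq> {}" unfolding C_def by blast
  qed
  have "C m \<noteq> C n" if "m \<noteq> n" for m n
    using C[of m] C[of n] main_ann_disjoint[OF that] by blast
  with sub comp have *: "(\<forall>n. Fatou_component sq_map (C n) \<and> sphere_iter sq_map n ` Fin ` ?W \<subseteq> C n) \<and>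
        (\<forall>m n. m \<ge> 1 \<and> n \<ge> 1 \<and> m \<noteq> n \<longrightarrow> C m \<noteq> C n)" by simp
  show ?thesis unfolding wandering_domain_def
    by (rule conjI[OF Fatou_component_trapped[OF p]], rule exI[of _ C], rule *)
qed

lemma escaping_trapped: "S \<subseteq> trapped m \<Longrightarrow> escaping sq_map (Fin ` S)"
  unfolding escaping_def loc_uniform_limit_def
  by (intro allI impI trapped_uniform_limit[OF filterlim_ident, of _ m]) blast

text \<open>The exponents \<open>32 * 2 ^ n + 1\<close> and \<open>48 * 2 ^ n - 1\<close> are
  exactly reproduced by the dyadic bounds, and they stay inside the main annuli, whose exponents are
  \<open>32 * 2 ^ n - 3\<close> and \<open>48 * 2 ^ n + 3\<close>.\<close>

lemma seed_trapped:
  assumes "2 ^ 33 \<le> cmod z" "cmod z \<le> 2 ^ 47"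
  shows "z \<in> trapped 0"
proof -
  define seed where "seed n = {w. 2 ^ Suc (32 * 2 ^ n) \<le> cmod w \<and> cmod w \<le> 2 ^ (48 * 2 ^ n - 1)}" for n
  have sub: "seed n \<subseteq> main_ann n" for n
  proof -
    have "(2::real) ^ (inner_exp n + 1) \<le> 2 ^ Suc (32 * 2 ^ n)"
      by (rule power_increasing) (use inner_exp_add[of n] in auto)
    moreover have "(2::real) ^ (48 * 2 ^ n - 1) \<le> 2 ^ (outer_exp n - 1)"
      by (rule power_increasing) (auto simp: outer_exp_def)
    ultimately show ?thesis unfolding main_ann_def seed_def by (blast intro: order_trans)
  qed
  have "(sq_map ^^ n) z \<in> seed n" for n
  proof (induction n)
    case 0
    show ?case using assms by (simp add: seed_def)
  next
    case (Suc n)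
    let ?w = "(sq_map ^^ n) z"
    have w: "?w \<in> main_ann n" using Suc sub by blast
    obtain k where "(2::nat) ^ n = Suc k" by (metis gr0_implies_Suc zero_less_numeral zero_less_power)
    then have "2 * (48 * 2 ^ n - 1) + 1 = 48 * 2 ^ Suc n - (1::nat)"
      "2 * (32 * 2 ^ n) + 1 = Suc (32 * 2 ^ Suc n)" by simp_all
    then show ?case
      using sq_map_bounds(1)[OF w, of "48 * 2 ^ n - 1"] sq_map_bounds(2)[OF w, of "32 * 2 ^ n"] Suc
      unfolding seed_def mem_Collect_eq funpow.simps comp_apply by metis
  qed
  then show ?thesis using sub unfolding trapped_def by auto
qed

section \<open>The growth function\<close>

lemma main_ann_ratio:
  assumes "z \<in> main_ann k"
  shows "cmod (sq_map z / z\<^sup>2 - 1) \<le> 1/16"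
proof -
  have z: "2 \<le> cmod z" using assms by (rule main_ann_ge_2)
  then have z4: "4 \<le> (cmod z)\<^sup>2" using power_mono[of 2 "cmod z" 2] by simp
  have "sq_map z / z\<^sup>2 - 1 = (sq_map z - z\<^sup>2) / z\<^sup>2" using z by (auto simp: diff_divide_distrib)
  then have "cmod (sq_map z / z\<^sup>2 - 1) = cmod (sq_map z - z\<^sup>2) / (cmod z)\<^sup>2"
    by (simp add: norm_divide norm_power)
  also have "\<dots> \<le> (1/4) / 4" using z4 main_ann_approx[OF assms] by (intro frac_le) auto
  finally show ?thesis by simp
qed

text \<open>This keeps the quotient off the branch cut of \<open>Ln\<close>.\<close>

lemma main_ann_ratio_Re:
  assumes "z \<in> main_ann k" shows "0 < Re (sq_map z / z\<^sup>2)"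
  using main_ann_ratio[OF assms] abs_Re_le_cmod[of "sq_map z / z\<^sup>2 - 1"] by simp

lemma main_ann_Ln_ratio:
  assumes "z \<in> main_ann k" shows "cmod (Ln (sq_map z / z\<^sup>2)) \<le> 1/8"
  using main_ann_ratio[OF assms] norm_Ln_le[of "sq_map z / z\<^sup>2 - 1"] by simp

lemma sq_map_eq_exp:
  assumes "z \<in> main_ann k" shows "sq_map z = z\<^sup>2 * exp (Ln (sq_map z / z\<^sup>2))"
proof -
  have "sq_map z / z\<^sup>2 \<noteq> 0" using main_ann_ratio_Re[OF assms] by force
  moreover have "z \<noteq> 0" using main_ann_ge_2[OF assms] by auto
  ultimately show ?thesis by simp
qed

lemma ln_norm_sq_map:
  assumes "z \<in> main_ann k"
  shows "\<bar>ln (cmod (sq_map z)) - 2 * ln (cmod z)\<bar> \<le> 1/8" "sq_map z \<noteq> 0"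
proof -
  have z: "cmod z > 0" using main_ann_ge_2[OF assms] by linarith
  have "cmod (sq_map z) = (cmod z)\<^sup>2 * exp (Re (Ln (sq_map z / z\<^sup>2)))"
    by (subst sq_map_eq_exp[OF assms]) (simp add: norm_mult norm_power)
  then have "ln (cmod (sq_map z)) = 2 * ln (cmod z) + Re (Ln (sq_map z / z\<^sup>2))"
    using z by (simp add: ln_mult ln_realpow)
  then show "\<bar>ln (cmod (sq_map z)) - 2 * ln (cmod z)\<bar> \<le> 1/8"
    using main_ann_Ln_ratio[OF assms] abs_Re_le_cmod[of "Ln (sq_map z / z\<^sup>2)"] by linarith
  show "sq_map z \<noteq> 0" using main_ann_ratio_Re[OF assms] by force
qed

text \<open>As in the construction of a Boettcher coordinate, \<open>log f^n\<close> telescopes to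
  \<open>2 ^ n\<close> times \<open>log z\<close> plus the sum of these terms for
  \<open>j < n\<close>; the logarithm is applied only to quotients near 1.\<close>

definition log_term :: "nat \<Rightarrow> complex \<Rightarrow> complex" where
  "log_term j z = Ln ((sq_map ^^ Suc j) z / ((sq_map ^^ j) z)\<^sup>2) / 2 ^ Suc j"

definition log_sum :: "nat \<Rightarrow> complex \<Rightarrow> complex" where
  "log_sum n z = (\<Sum>j<n. log_term j z)"

definition log_lim :: "complex \<Rightarrow> complex" where
  "log_lim z = (\<Sum>j. log_term j z)"

definition growth :: "complex \<Rightarrow> real" where
  "growth z = ln (cmod z) + Re (log_lim z)"

lemma trapped_main_ann: "z \<in> trapped 0 \<Longrightarrow> (sq_map ^^ n) z \<in> main_ann n"
  unfolding trapped_def by simp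

lemma norm_log_term:
  assumes "z \<in> trapped 0" shows "cmod (log_term j z) \<le> (1/16) * (1/2) ^ j"
  using main_ann_Ln_ratio[OF trapped_main_ann[OF assms, of j]]
  by (simp add: log_term_def norm_divide norm_mult norm_power power_divide field_simps)

lemma summable_log_bound: "summable (\<lambda>j. (1/16) * (1/2) ^ j :: real)"
  by (intro summable_mult summable_geometric) simp

lemma norm_log_lim:
  assumes "z \<in> trapped 0" shows "cmod (log_lim z) \<le> 1/8"
proof -
  have "cmod (log_lim z) \<le> (\<Sum>j. (1/16) * (1/2) ^ j :: real)"
    unfolding log_lim_def by (intro norm_suminf_le norm_log_term assms summable_log_bound)
  also have "\<dots> = 1/8" by (subst suminf_mult) (auto simp: suminf_geometric summable_geometric)
  finally show ?thesis .
qed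

lemma log_sum_uniform_limit: "uniform_limit (trapped 0) log_sum log_lim sequentially"
  unfolding log_sum_def[abs_def] log_lim_def[abs_def]
  by (rule Weierstrass_m_test[OF norm_log_term summable_log_bound])

text \<open>The power \<open>z ^ (2 ^ n)\<close> takes the place of
  \<open>exp (2 ^ n * log z)\<close>, since no branch of the logarithm exists on an annulus around
  0.\<close>

lemma funpow_eq_exp:
  assumes "z \<in> trapped 0"
  shows "(sq_map ^^ n) z = z ^ (2 ^ n) * exp (2 ^ n * log_sum n z)"
proof (induction n)
  case (Suc n)
  define w where "w = (sq_map ^^ n) z"
  have "2 ^ Suc n * log_sum (Suc n) z = 2 * (2 ^ n * log_sum n z) + Ln (sq_map w / w\<^sup>2)"
    by (simp add: log_sum_def log_term_def w_def algebra_simps)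
  then have "exp (2 ^ Suc n * log_sum (Suc n) z) = (exp (2 ^ n * log_sum n z))\<^sup>2 * exp (Ln (sq_map w / w\<^sup>2))"
    by (simp add: exp_add exp_double)
  moreover have "z ^ (2 ^ Suc n) = (z ^ (2 ^ n))\<^sup>2" by (simp add: power_mult mult.commute[of 2])
  moreover have "w = z ^ (2 ^ n) * exp (2 ^ n * log_sum n z)" using Suc.IH by (simp add: w_def)
  ultimately have "z ^ (2 ^ Suc n) * exp (2 ^ Suc n * log_sum (Suc n) z) = w\<^sup>2 * exp (Ln (sq_map w / w\<^sup>2))"
    by (simp add: power_mult_distrib)
  also have "\<dots> = sq_map w"
    using sq_map_eq_exp[OF trapped_main_ann[OF assms, of n]] by (simp add: w_def)
  finally show ?case by (simp add: w_def)
qed (simp add: log_sum_def)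

lemma trapped_nonzero: "z \<in> trapped 0 \<Longrightarrow> 2 \<le> cmod ((sq_map ^^ n) z)"
  using main_ann_ge_2 trapped_main_ann by blast

lemma ln_norm_funpow:
  assumes "z \<in> trapped 0"
  shows "ln (cmod ((sq_map ^^ n) z)) = 2 ^ n * (ln (cmod z) + Re (log_sum n z))"
proof -
  have "2 \<le> cmod z" using trapped_nonzero[OF assms, of 0] by simp
  then have z: "cmod z > 0" by linarith
  have "(2::complex) ^ n = of_real (2 ^ n)" by simp
  then have "Re (2 ^ n * log_sum n z) = 2 ^ n * Re (log_sum n z)"
    by (simp only: Re_complex_of_real Im_complex_of_real times_complex.sel)
  then show ?thesis
    using z by (simp add: funpow_eq_exp[OF assms] norm_mult norm_power ln_mult ln_realpow algebra_simps)
qed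

lemma growth_lim:
  assumes "z \<in> trapped 0"
  shows "(\<lambda>n. ln (cmod ((sq_map ^^ n) z)) / 2 ^ n) \<longlonglongrightarrow> growth z"
proof -
  have "(\<lambda>n. log_sum n z) \<longlonglongrightarrow> log_lim z"
    using tendsto_uniform_limitI[OF log_sum_uniform_limit assms] .
  then have "(\<lambda>n. ln (cmod z) + Re (log_sum n z)) \<longlonglongrightarrow> growth z"
    unfolding growth_def by (intro tendsto_intros)
  moreover have "ln (cmod ((sq_map ^^ n) z)) / 2 ^ n = ln (cmod z) + Re (log_sum n z)" for n
    by (simp add: ln_norm_funpow[OF assms])
  ultimately show ?thesis by simp
qed

lemma growth_bound:
  assumes "z \<in> trapped 0" shows "\<bar>growth z - ln (cmod z)\<bar> \<le> 1/8"
  using norm_log_lim[OF assms] abs_Re_le_cmod[of "log_lim z"] by (simp add: growth_def)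

lemma growth_pos:
  assumes "z \<in> trapped 0" shows "0 < growth z"
proof -
  have "2 \<le> cmod z" using trapped_nonzero[OF assms, of 0] by simp
  then have "ln 2 \<le> ln (cmod z)" by (intro ln_mono) auto
  then show ?thesis using growth_bound[OF assms] ln2_ge_two_thirds by linarith
qed

section \<open>Holomorphy and harmonicity\<close>

lemma log_term_holomorphic: "log_term j holomorphic_on interior (trapped 0)"
proof -
  have fp: "(sq_map ^^ n) holomorphic_on interior (trapped 0)" for n
  proof (rule analytic_imp_holomorphic, subst analytic_on_analytic_at, rule ballI)
    fix z assume "z \<in> interior (trapped 0)"
    then show "(sq_map ^^ n) analytic_on {z}" using trapped_funpow_analytic interior_subset by blast
  qed
  have nz: "(sq_map ^^ j) z \<noteq> 0" if "z \<in> interior (trapped 0)" for z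
    using trapped_nonzero[of z j] that interior_subset by force
  have "(sq_map ^^ Suc j) z / ((sq_map ^^ j) z)\<^sup>2 \<notin> \<real>\<^sub>\<le>\<^sub>0" if "z \<in> interior (trapped 0)" for z
  proof -
    have "z \<in> trapped 0" using that interior_subset by blast
    from main_ann_ratio_Re[OF trapped_main_ann[OF this, of j]]
    have "0 < Re ((sq_map ^^ Suc j) z / ((sq_map ^^ j) z)\<^sup>2)" by simp
    then show ?thesis unfolding complex_nonpos_Reals_iff by linarith
  qed
  then have "(\<lambda>z. Ln ((sq_map ^^ Suc j) z / ((sq_map ^^ j) z)\<^sup>2) / 2 ^ Suc j) holomorphic_on interior (trapped 0)"
    by (intro holomorphic_intros fp) (use nz in auto)
  then show ?thesis by (simp only: log_term_def[abs_def])
qed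

lemma log_sum_holomorphic: "log_sum n holomorphic_on interior (trapped 0)"
  unfolding log_sum_def[abs_def] by (intro holomorphic_intros log_term_holomorphic)

lemma log_lim_holomorphic: "log_lim holomorphic_on interior (trapped 0)"
proof (rule holomorphic_uniform_sequence[OF open_interior log_sum_holomorphic])
  fix x assume "x \<in> interior (trapped 0)"
  then obtain d where d: "d > 0" "cball x d \<subseteq> interior (trapped 0)"
    using open_interior[of "trapped 0", unfolded open_contains_cball] by blast
  then have "cball x d \<subseteq> trapped 0" using interior_subset by blast
  then have "uniform_limit (cball x d) log_sum log_lim sequentially"
    by (rule uniform_limit_on_subset[OF log_sum_uniform_limit])
  with d show "\<exists>d>0. cball x d \<subseteq> interior (trapped 0) \<and>
      uniform_limit (cball x d) log_sum log_lim sequentially" by blast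
qed

text \<open>The derivative of \<open>log z + log_lim z\<close>, single-valued although the logarithm
  is not; \<open>growth\<close> is the real part of that function.\<close>

definition growth' :: "complex \<Rightarrow> complex" where "growth' z = 1 / z + deriv log_lim z"

text \<open>Near \<open>z\<close> the branch \<open>Ln (w / z)\<close> is holomorphic, its argument
  being near 1, and \<open>ln (cmod w)\<close> is its real part up to a constant.\<close>

lemma ln_norm_has_derivative:
  assumes "z \<noteq> 0"
  shows "((\<lambda>z. ln (cmod z)) has_derivative (\<lambda>v. Re (v * (1 / z)))) (at z)"
proof -
  have "((\<lambda>w. Ln (w / z)) has_field_derivative (1 / z)) (at z)"
    using assms by (auto intro!: derivative_eq_intros)
  then have "((\<lambda>w. Ln (w / z)) has_derivative (\<lambda>v. v * (1 / z))) (at z)"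
    by (simp only: has_field_derivative_def mult_commute_abs)
  then have "((\<lambda>w. Re (Ln (w / z)) + ln (cmod z)) has_derivative (\<lambda>v. Re (v * (1 / z)))) (at z)"
    by (auto intro!: derivative_eq_intros)
  then show ?thesis
  proof (rule has_derivative_transform_within_open[of _ _ _ _ "- {0}"])
    fix w assume "w \<in> - {0::complex}"
    then show "Re (Ln (w / z)) + ln (cmod z) = ln (cmod w)"
      using assms by (simp add: norm_divide ln_div)
  qed (use assms in auto)
qed

lemma growth_has_derivative:
  assumes "z \<in> interior (trapped 0)"
  shows "(growth has_derivative (\<lambda>v. Re (v * growth' z))) (at z)"
proof -
  have "2 \<le> cmod z" using trapped_nonzero[of z 0] assms interior_subset by force
  then have z: "z \<noteq> 0" by auto
  have "(log_lim has_derivative (\<lambda>v. v * deriv log_lim z)) (at z)"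
    using holomorphic_derivI[OF log_lim_holomorphic open_interior assms]
    by (simp add: has_field_derivative_def mult_commute_abs)
  from has_derivative_add[OF ln_norm_has_derivative[OF z] has_derivative_Re[OF this]]
  show ?thesis by (simp add: growth_def[abs_def] growth'_def distrib_left)
qed

lemma growth'_holomorphic: "growth' holomorphic_on interior (trapped 0)"
proof -
  have "z \<noteq> 0" if "z \<in> interior (trapped 0)" for z
    using trapped_nonzero[of z 0] that interior_subset by force
  then show ?thesis unfolding growth'_def[abs_def]
    by (intro holomorphic_intros log_lim_holomorphic holomorphic_deriv open_interior) auto
qed

text \<open>Locally \<open>u\<close> is the real part of a primitive of \<open>D\<close>, which may
  have no global primitive. The second derivative is \<open>Re (v * (w * deriv D z))\<close>, and
  its values at the pairs \<open>(1, 1)\<close> and \<open>(\<i>, \<i>)\<close> cancel.\<close>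

lemma harmonic_on_Re_deriv:
  fixes u :: "complex \<Rightarrow> real" and D :: "complex \<Rightarrow> complex"
  assumes S: "open S" and D: "D holomorphic_on S"
    and u: "\<And>z. z \<in> S \<Longrightarrow> (u has_derivative (\<lambda>v. Re (v * D z))) (at z)"
  shows "harmonic_on S u"
proof -
  define B :: "complex \<Rightarrow> complex \<Rightarrow>\<^sub>L real" where "B a = Blinfun Re o\<^sub>L blinfun_mult_left a" for a
  have B: "blinfun_apply (B a) v = Re (v * a)" for a v
    by (simp add: B_def bounded_linear_Blinfun_apply bounded_linear_Re)
  have blB: "bounded_linear B" unfolding B_def
    by (intro bounded_linear_compose[OF blinfun.bounded_linear_right] bounded_linear_intros
        bounded_linear_compose[OF bounded_bilinear.bounded_linear_right[OF bounded_bilinear_blinfun_compose]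
          bounded_linear_blinfun_mult_left])
  define u'' where "u'' z = Blinfun B o\<^sub>L blinfun_mult_left (deriv D z)" for z
  have u'': "blinfun_apply (u'' z) w = B (w * deriv D z)" for z w
    by (simp add: u''_def bounded_linear_Blinfun_apply blB)
  have "((\<lambda>z. B (D z)) has_derivative blinfun_apply (u'' z)) (at z)" if "z \<in> S" for z
  proof -
    have "(D has_derivative (\<lambda>w. w * deriv D z)) (at z)"
      using holomorphic_derivI[OF D S that] by (simp add: has_field_derivative_def mult_commute_abs)
    from bounded_linear.has_derivative[OF blB this]
    show ?thesis by (simp only: u''[THEN ext])
  qed
  moreover have "continuous_on S u''"
    unfolding u''_def
    by (intro continuous_intros bounded_linear.continuous_on[OF bounded_linear_blinfun_mult_left]
        holomorphic_on_imp_continuous_on holomorphic_deriv D S)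
  moreover have "blinfun_apply (blinfun_apply (u'' z) 1) 1
               + blinfun_apply (blinfun_apply (u'' z) \<i>) \<i> = 0" for z
    by (simp add: u'' B)
  moreover have "(u has_derivative blinfun_apply (B (D z))) (at z)" if "z \<in> S" for z
    using u[OF that] by (simp only: B[THEN ext])
  ultimately show ?thesis unfolding harmonic_on_def
    using S by (intro conjI exI[of _ "\<lambda>z. B (D z)"] exI[of _ u'']) auto
qed

lemma growth_harmonic:
  assumes "open W" "W \<subseteq> interior (trapped 0)"
  shows "harmonic_on W (\<lambda>z. growth z / c)"
proof (rule harmonic_on_Re_deriv[where D = "\<lambda>z. growth' z / of_real c"])
  show "(\<lambda>z. growth' z / of_real c) holomorphic_on W"
    using holomorphic_on_subset[OF growth'_holomorphic assms(2)]
    by (cases "c = 0") (auto intro!: holomorphic_intros)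
  fix z assume "z \<in> W"
  then have "(growth has_derivative (\<lambda>v. Re (v * growth' z))) (at z)"
    using assms growth_has_derivative by blast
  from has_derivative_mult_left[OF this, of "1 / c"]
  show "((\<lambda>z. growth z / c) has_derivative (\<lambda>v. Re (v * (growth' z / of_real c)))) (at z)"
    by (simp add: Re_divide_of_real)
qed (rule assms)

text \<open>Constancy on \<open>B\<close> makes \<open>growth'\<close> vanish there; the identity
  theorem extends this to the connected \<open>W\<close>, where \<open>growth\<close> would then be
  constant.\<close>

lemma growth_locally_nonconstant:
  assumes W: "open W" "connected W" "W \<subseteq> interior (trapped 0)" and nc: "\<not> growth constant_on W"
    and B: "open B" "B \<noteq> {}" "B \<subseteq> W"
  shows "\<not> growth constant_on B"
proof
  assume "growth constant_on B"
  then obtain c where c: "\<And>z. z \<in> B \<Longrightarrow> growth z = c" by (auto simp: constant_on_def)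
  have zero: "growth' z = 0" if "z \<in> B" for z
  proof -
    have "(growth has_derivative (\<lambda>v. Re (v * growth' z))) (at z)"
      using that B(3) W(3) growth_has_derivative by blast
    moreover have "((\<lambda>_. c) has_derivative (\<lambda>v. 0)) (at z)" by simp
    then have "(growth has_derivative (\<lambda>v. 0)) (at z)"
      by (rule has_derivative_transform_within_open[OF _ B(1) that]) (simp add: c)
    ultimately have "(\<lambda>v. Re (v * growth' z)) = (\<lambda>v. 0)" by (rule has_derivative_unique)
    \<comment> \<open>The value at the conjugate of \<open>growth' z\<close> is its squared
      modulus.\<close>
    then have "Re (cnj (growth' z) * growth' z) = 0" by metis
    then have "(Re (growth' z))\<^sup>2 + (Im (growth' z))\<^sup>2 = 0" by (simp add: power2_eq_square)
    then show ?thesis by (simp add: complex_eq_iff sum_power2_eq_zero_iff)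
  qed
  have "growth' z = 0" if "z \<in> W" for z
    using analytic_continuation_open[OF B(1) W(1) B(2) W(2) B(3) holomorphic_on_subset[OF growth'_holomorphic W(3)]
        holomorphic_on_const[of 0] _ that] zero by blast
  then have d: "(growth has_derivative (\<lambda>v. 0)) (at z)" if "z \<in> W" for z
    using growth_has_derivative[of z] that W(3) by auto
  have "growth constant_on W"
    unfolding constant_on_def using has_derivative_zero_unique_connected[OF W(1,2) d] by blast
  with nc show False by blast
qed

section \<open>Covered annuli\<close>

lemma two_power_mult_at_top:
  assumes "(c::real) > 0" shows "filterlim (\<lambda>n. 2 ^ n * c) at_top sequentially"
proof (rule filterlim_at_top_mono)
  show "filterlim (\<lambda>n. real n * c) at_top sequentially"
    by (rule filterlim_at_top_mult_tendsto_pos[OF tendsto_const assms filterlim_real_sequentially])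
  show "\<forall>\<^sub>F n in sequentially. real n * c \<le> 2 ^ n * c"
    using assms by (intro always_eventually allI mult_right_mono less_imp_le[OF of_nat_less_two_power]) auto
qed

text \<open>In the chart \<open>z \<mapsto> Ln z + log_sum n z\<close> the \<open>n\<close>-th iterate is \<open>\<zeta> \<mapsto> exp (2 ^ n \<zeta>)\<close>, and these charts
  converge uniformly to a non-constant holomorphic function, so that their images contain a fixed
  disc.\<close>

lemma funpow_covers_annulus:
  assumes B: "open B" "z0 \<in> B" "B \<subseteq> interior (trapped 0)"
    and nc: "\<And>S. open S \<Longrightarrow> S \<noteq> {} \<Longrightarrow> S \<subseteq> B \<Longrightarrow> \<not> growth constant_on S"
  obtains \<epsilon> where "\<epsilon> > 0" "\<forall>\<^sub>F n in sequentially.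
    annulus (cmod ((sq_map ^^ n) z0) * exp (- (2 ^ n * \<epsilon>))) (cmod ((sq_map ^^ n) z0) * exp (2 ^ n * \<epsilon>))
      \<subseteq> (sq_map ^^ n) ` B"
proof -
  have tr: "z \<in> trapped 0" if "z \<in> B" for z using that B(3) interior_subset by blast
  have z0: "2 \<le> cmod z0" using trapped_nonzero[OF tr[OF B(2)], of 0] by simp
  then have z0': "z0 \<noteq> 0" by auto
  define S where "S = B \<inter> ball z0 1"
  have "open S" "z0 \<in> S" using B by (auto simp: S_def)
  then obtain \<rho> where \<rho>: "\<rho> > 0" "ball z0 \<rho> \<subseteq> S" by (meson open_contains_ball)
  define U where "U = ball z0 \<rho>"
  have U: "open U" "connected U" "z0 \<in> U" "U \<subseteq> B" "U \<subseteq> interior (trapped 0)" "U \<subseteq> trapped 0"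
    using \<rho> B(3) tr by (auto simp: U_def S_def)
  \<comment> \<open>A branch of the logarithm on \<open>U\<close>: points of \<open>U\<close> are
    within 1 of \<open>z0\<close> and \<open>|z0| >= 2\<close>, so \<open>z / z0\<close> stays in
    the right half-plane.\<close>
  define L where "L z = Ln (z / z0) + Ln z0" for z
  have Re_pos: "0 < Re (z / z0)" if "z \<in> U" for z
  proof -
    have "cmod (z - z0) < 1" using that \<rho>(2) by (auto simp: U_def S_def dist_norm norm_minus_commute)
    then have "cmod (z - z0) < cmod z0" using z0 by linarith
    then have "cmod ((z - z0) / z0) < 1" using z0' by (simp add: norm_divide)
    then have "cmod (z / z0 - 1) < 1" using z0' by (simp add: diff_divide_distrib)
    then show ?thesis using abs_Re_le_cmod[of "z / z0 - 1"] by simp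
  qed
  have L: "L holomorphic_on U" unfolding L_def
    by (intro holomorphic_intros) (use Re_pos z0' in \<open>force simp: complex_nonpos_Reals_iff\<close>)+
  have expL: "exp (L z) = z" if "z \<in> U" for z
    using Re_pos[OF that] z0' by (cases "z = 0") (auto simp: L_def exp_add)
  define g where "g z = L z + log_lim z" for z
  define G where "G n z = L z + log_sum n z" for n z
  have g: "g holomorphic_on U" unfolding g_def
    by (intro holomorphic_intros L holomorphic_on_subset[OF log_lim_holomorphic U(5)])
  have G: "G n holomorphic_on U" for n unfolding G_def
    by (intro holomorphic_intros L holomorphic_on_subset[OF log_sum_holomorphic U(5)])
  have expG: "(sq_map ^^ n) z = exp (2 ^ n * G n z)" if "z \<in> U" for n z
  proof -
    have "exp (2 ^ n * L z) = z ^ (2 ^ n)"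
      using exp_of_nat_mult[of "2 ^ n" "L z"] expL[OF that] by simp
    then show ?thesis using funpow_eq_exp[of z n] that U(6)
      by (auto simp: G_def distrib_left exp_add)
  qed
  have Re_g: "Re (g z) = growth z" if "z \<in> U" for z
  proof -
    have "exp (Re (L z)) = cmod z" using expL[OF that] by (metis norm_exp_eq_Re)
    then have "Re (L z) = ln (cmod z)" by (metis ln_exp)
    then show ?thesis by (simp add: g_def growth_def)
  qed
  have "\<exists>\<beta>\<in>U. g \<beta> \<noteq> g z0"
  proof (rule ccontr)
    assume "\<not> ?thesis"
    then have "growth z = growth z0" if "z \<in> U" for z using Re_g[OF that] Re_g[OF U(3)] that by metis
    then have "growth constant_on U" by (auto simp: constant_on_def)
    with nc[OF U(1) _ U(4)] U(3) show False by blast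
  qed
  then obtain \<beta> where \<beta>: "\<beta> \<in> U" "g \<beta> - g z0 \<noteq> 0" by auto
  obtain r0 where r0: "0 < r0" "ball z0 r0 \<subseteq> U" "\<And>z. z \<in> ball z0 r0 - {z0} \<Longrightarrow> g z - g z0 \<noteq> 0"
  proof (rule isolated_zeros[of "\<lambda>z. g z - g z0" U z0 \<beta>])
    show "(\<lambda>z. g z - g z0) holomorphic_on U" by (intro holomorphic_intros g)
  qed (use U \<beta> in auto)
  \<comment> \<open>Halving the radius keeps the whole circle inside the disc where \<open>g\<close>
    takes the value \<open>g z0\<close> only at the centre.\<close>
  define r where "r = r0 / 2"
  have r: "0 < r" "cball z0 r \<subseteq> ball z0 r0" using r0(1) by (auto simp: r_def)
  have sph: "sphere z0 r \<subseteq> ball z0 r0 - {z0}" using r by auto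
  have cg: "continuous_on (sphere z0 r) (\<lambda>z. cmod (g z - g z0))"
    using sph r0(2) by (intro continuous_intros continuous_on_subset[OF holomorphic_on_imp_continuous_on[OF g]]) auto
  have ne: "sphere z0 r \<noteq> {}" using r by simp
  obtain w where w: "w \<in> sphere z0 r" "\<And>z. z \<in> sphere z0 r \<Longrightarrow> cmod (g w - g z0) \<le> cmod (g z - g z0)"
    using continuous_attains_inf[OF compact_sphere ne cg] by blast
  define e where "e = cmod (g w - g z0)"
  have "w \<in> ball z0 r0 - {z0}" using sph w(1) by blast
  from r0(3)[OF this] have e: "e > 0" by (simp add: e_def)
  have "\<forall>\<^sub>F n in sequentially. \<forall>z\<in>trapped 0. dist (log_sum n z) (log_lim z) < e / 4"
    by (rule uniform_limitD[OF log_sum_uniform_limit]) (use e in simp)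
  \<comment> \<open>The values of \<open>Ln (y / a)\<close> have real part below
    \<open>2 ^ n * (e / 4)\<close> in absolute value and imaginary part at most \<open>pi\<close>. A
    bound above \<open>pi\<close> puts them into the disc of radius
    \<open>2 ^ n * (e / 2)\<close>.\<close>
  moreover have "filterlim (\<lambda>n. 2 ^ n * (e / 4) :: real) at_top sequentially"
    using e by (intro two_power_mult_at_top) simp
  then have "\<forall>\<^sub>F n in sequentially. 2 ^ n * (e / 4) \<ge> pi + 1"
    unfolding filterlim_at_top by blast
  ultimately have "\<forall>\<^sub>F n in sequentially.
    annulus (cmod ((sq_map ^^ n) z0) * exp (- (2 ^ n * (e / 4)))) (cmod ((sq_map ^^ n) z0) * exp (2 ^ n * (e / 4)))
      \<subseteq> (sq_map ^^ n) ` B"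
  proof eventually_elim
    case (elim n)
    have close: "cmod (G n z - g z) < e / 4" if "z \<in> U" for z
      using elim(1) that U(6) by (auto simp: G_def g_def dist_norm)
    have ge: "e / 2 \<le> cmod (G n z - G n z0)" if "z \<in> sphere z0 r" for z
    proof -
      have zU: "z \<in> U" using that sph r0(2) by blast
      have "e \<le> cmod (g z - g z0)" using w(2)[OF that] by (simp add: e_def)
      also have "g z - g z0 = (G n z - G n z0) - (G n z - g z) + (G n z0 - g z0)" by simp
      also have "cmod \<dots> \<le> cmod (G n z - G n z0) + cmod (G n z - g z) + cmod (G n z0 - g z0)"
        by (metis (no_types, opaque_lifting) add_mono_thms_linordered_semiring(3) norm_triangle_ineq norm_triangle_ineq4 order_trans)
      finally show ?thesis using close[OF zU] close[OF U(3)] by linarith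
    qed
    have op: "open (G n ` ball z0 r)"
    proof (rule open_mapping_thm[of _ "ball z0 r0"])
      show "G n holomorphic_on ball z0 r0" using G r0(2) holomorphic_on_subset by blast
      show "ball z0 r \<subseteq> ball z0 r0" using r by (auto simp: r_def)
      show "\<not> G n constant_on ball z0 r0"
      proof
        assume "G n constant_on ball z0 r0"
        then have "G n w = G n z0" using w(1) sph r0(1) unfolding constant_on_def by (metis Diff_iff centre_in_ball subsetD)
        with ge[OF w(1)] e show False by simp
      qed
    qed auto
    \<comment> \<open>Quantitative open mapping: the circle is moved at least \<open>e / 2\<close>
      away from the centre value, with \<open>e\<close> independent of \<open>n\<close>.\<close>
    have cov: "ball (G n z0) (e / 2) \<subseteq> G n ` cball z0 r"
    proof (rule ball_subset_open_map_image)
      show "continuous_on (closure (cball z0 r)) (G n)"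
        using r(2) r0(2) by (intro continuous_on_subset[OF holomorphic_on_imp_continuous_on[OF G]]) auto
      show "open (G n ` interior (cball z0 r))" using op by simp
      show "e / 2 \<le> norm (G n z - G n z0)" if "z \<in> frontier (cball z0 r)" for z
        using ge that r(1) by simp
    qed (use r(1) e in auto)
    show ?case
    proof
      fix y assume y: "y \<in> annulus (cmod ((sq_map ^^ n) z0) * exp (- (2 ^ n * (e / 4)))) (cmod ((sq_map ^^ n) z0) * exp (2 ^ n * (e / 4)))"
      define a where "a = (sq_map ^^ n) z0"
      have a: "cmod a > 0" using trapped_nonzero[OF tr[OF B(2)], of n] unfolding a_def by linarith
      then have a0: "a \<noteq> 0" by auto
      have y1: "cmod a * exp (- (2 ^ n * (e / 4))) < cmod y" "cmod y < cmod a * exp (2 ^ n * (e / 4))"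
        using y by (auto simp: annulus_def a_def)
      have "0 < cmod a * exp (- (2 ^ n * (e / 4)))" using a by simp
      with y1 have y0: "cmod y > 0" by linarith
      then have u0: "y / a \<noteq> 0" using a0 by auto
      have "exp (- (2 ^ n * (e / 4))) < cmod (y / a)" "cmod (y / a) < exp (2 ^ n * (e / 4))"
        using y1 a by (simp_all add: norm_divide field_simps)
      then have "ln (exp (- (2 ^ n * (e / 4)))) < ln (cmod (y / a))" "ln (cmod (y / a)) < ln (exp (2 ^ n * (e / 4)))"
        using u0 by (subst ln_less_cancel_iff; force)+
      then have re: "\<bar>Re (Ln (y / a))\<bar> < 2 ^ n * (e / 4)" using u0 by simp
      have im: "\<bar>Im (Ln (y / a))\<bar> \<le> pi" using Im_Ln_le_pi[OF u0] mpi_less_Im_Ln[OF u0] by linarith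
      have "cmod (Ln (y / a)) < 2 ^ n * (e / 2)"
        using cmod_le[of "Ln (y / a)"] re im elim(2) by simp
      then have "cmod (Ln (y / a) / 2 ^ n) < e / 2"
        by (simp add: norm_divide norm_power field_simps)
      then have "G n z0 + Ln (y / a) / 2 ^ n \<in> ball (G n z0) (e / 2)" by (simp add: dist_norm)
      with cov obtain z where z: "z \<in> cball z0 r" "G n z = G n z0 + Ln (y / a) / 2 ^ n" by (metis (no_types, lifting) imageE subsetD)
      have zU: "z \<in> U" using z(1) r(2) r0(2) by blast
      have "(sq_map ^^ n) z = exp (2 ^ n * G n z0 + Ln (y / a))"
        unfolding expG[OF zU] z(2) by (simp add: distrib_left)
      also have "\<dots> = a * (y / a)" using u0 expG[OF U(3), of n] by (simp add: exp_add a_def)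
      finally have "(sq_map ^^ n) z = y" using a0 by simp
      then show "y \<in> (sq_map ^^ n) ` B" using zU U(4) by blast
    qed
  qed
  with e show thesis by (intro that[of "e / 4"]) auto
qed

text \<open>The image of the open annulus is open, that of the closed one is closed. Inside the
  target annulus they agree, because the boundary circles are mapped outside it: the margin 1
  exceeds the error 1/8 of the logarithm. The connected target meets the image, at a point of mean
  logarithmic modulus, and is thus contained in it.\<close>

lemma sq_map_covers:
  assumes sub: "{z. exp s \<le> cmod z \<and> cmod z \<le> exp t} \<subseteq> open_ann k" and st: "2 \<le> t - s"
  shows "annulus (exp (2 * s + 1)) (exp (2 * t - 1)) \<subseteq> sq_map ` annulus (exp s) (exp t)"
proof -
  let ?A = "annulus (exp s) (exp t)" and ?A' = "annulus (exp (2 * s + 1)) (exp (2 * t - 1))"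
  let ?C = "{z. exp s \<le> cmod z \<and> cmod z \<le> exp t}"
  have Csub: "?C \<subseteq> main_ann k" using sub open_ann_subset by blast
  have AC: "?A \<subseteq> ?C" by (auto simp: annulus_def)
  have ln_est: "\<bar>ln (cmod (sq_map z)) - 2 * ln (cmod z)\<bar> \<le> 1/8" "cmod (sq_map z) > 0" if "z \<in> ?C" for z
    using ln_norm_sq_map[of z k] that Csub by auto
  have "open ?A"
    unfolding annulus_def by (intro open_Collect_conj open_Collect_less continuous_intros)
  then have "open (sq_map ` ?A)" using AC sub by (intro open_sq_map_image[of _ k]) blast+
  have "continuous_on ?C sq_map"
    using Csub main_ann_regular sq_map_analytic
    by (intro continuous_at_imp_continuous_on ballI analytic_at_imp_isCont) blast
  moreover have "compact ?C"
  proof -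
    have "closed ?C" by (intro closed_Collect_conj closed_Collect_le continuous_intros)
    moreover have "bounded ?C" by (rule bounded_subset[OF bounded_cball[of 0 "exp t"]]) auto
    ultimately show ?thesis by (simp add: compact_eq_bounded_closed)
  qed
  ultimately have "closed (sq_map ` ?C)" by (intro compact_imp_closed compact_continuous_image)
  have sep: "y \<in> sq_map ` ?A" if "y \<in> sq_map ` ?C" "y \<in> ?A'" for y
  proof -
    obtain z where z: "z \<in> ?C" "y = sq_map z" using \<open>y \<in> sq_map ` ?C\<close> by blast
    have "exp (2 * s + 1) < cmod y" "cmod y < exp (2 * t - 1)" using \<open>y \<in> ?A'\<close> by (auto simp: annulus_def)
    then have "2 * s + 1 < ln (cmod y)" "ln (cmod y) < 2 * t - 1"
      using ln_est(2)[OF z(1)] z(2) ln_less_cancel_iff[of "exp (2 * s + 1)" "cmod y"]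
        ln_less_cancel_iff[of "cmod y" "exp (2 * t - 1)"] by auto
    then have *: "s < ln (cmod z)" "ln (cmod z) < t" using ln_est(1)[OF z(1)] unfolding z(2) by linarith+
    have "cmod z > 0" using z(1) by (auto intro: less_le_trans[OF exp_gt_zero])
    then have "exp (ln (cmod z)) = cmod z" by simp
    with * have "exp s < cmod z" "cmod z < exp t" using exp_less_cancel_iff by metis+
    then show ?thesis using z(2) by (auto simp: annulus_def)
  qed
  have "connected ?A'"
    using connected_annulus(1)[of "exp (2 * s + 1)" "0::complex" "exp (2 * t - 1)"] by (simp add: annulus_def)
  moreover have "?A' \<subseteq> sq_map ` ?A \<union> - (sq_map ` ?C)" using sep by blast
  moreover have "sq_map ` ?A \<inter> - (sq_map ` ?C) \<inter> ?A' = {}" using AC by blast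
  moreover have "sq_map ` ?A \<inter> ?A' \<noteq> {}"
  proof -
    define z where "z = complex_of_real (exp ((s + t) / 2))"
    have nz: "cmod z = exp ((s + t) / 2)" by (simp add: z_def)
    then have zA: "z \<in> ?A" using st by (simp add: annulus_def)
    then have zC: "z \<in> ?C" using AC by blast
    have "2 * ln (cmod z) = s + t" by (simp add: nz field_simps)
    then have "\<bar>ln (cmod (sq_map z)) - (s + t)\<bar> \<le> 1/8" using ln_est(1)[OF zC] by linarith
    then have *: "2 * s + 1 < ln (cmod (sq_map z))" "ln (cmod (sq_map z)) < 2 * t - 1"
      using st by linarith+
    have "exp (ln (cmod (sq_map z))) = cmod (sq_map z)" using ln_est(2)[OF zC] by simp
    with * have "exp (2 * s + 1) < cmod (sq_map z)" "cmod (sq_map z) < exp (2 * t - 1)"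
      using exp_less_cancel_iff by metis+
    then have "sq_map z \<in> ?A'" by (simp add: annulus_def)
    with zA show ?thesis by blast
  qed
  ultimately have "?A' \<inter> - (sq_map ` ?C) = {}"
    using connectedD[of ?A' "sq_map ` ?A" "- (sq_map ` ?C)"] \<open>open (sq_map ` ?A)\<close> \<open>closed (sq_map ` ?C)\<close>
    by (auto simp: open_Compl)
  then show ?thesis using sep by blast
qed

section \<open>Vanishing deficiency\<close>

lemma integral_nonneg_any:
  fixes f :: "real \<Rightarrow> real"
  assumes "\<And>x. x \<in> S \<Longrightarrow> 0 \<le> f x" shows "0 \<le> integral S f"
  using assms by (cases "f integrable_on S") (auto intro: integral_nonneg simp: not_integrable_integral)

lemma dead_circle: "cmod z = 2 ^ (outer_exp k + 1) \<Longrightarrow> z \<in> dead"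
proof -
  assume z: "cmod z = 2 ^ (outer_exp k + 1)"
  have "(2::real) ^ (outer_exp k + 1) \<le> 2 ^ (inner_exp (Suc k) - 1)"
    using exps_less(2)[of k "Suc k"] by (intro power_increasing) auto
  with z show "z \<in> dead" unfolding dead_def by auto
qed

lemma dead_small: "cmod z \<le> 1 \<Longrightarrow> z \<in> dead"
  by (simp add: dead_def inner_exp_def)

lemma proximity_nonneg: "0 \<le> proximity r f"
  unfolding proximity_def by (intro mult_nonneg_nonneg integral_nonneg_any) auto

lemma proximity_dead_circle: "proximity (2 ^ (outer_exp k + 1)) sq_map = 0"
proof -
  have "max 1 (cmod (sq_map (of_real (2 ^ (outer_exp k + 1)) * cis \<theta>))) = 1" for \<theta>
    using dead_bound[OF dead_circle[of "of_real (2 ^ (outer_exp k + 1)) * cis \<theta>" k]]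
    by (simp add: norm_mult norm_power)
  then show ?thesis unfolding proximity_def by (simp only: ln_one integral_0 mult_zero_right)
qed

text \<open>The ratio is nonnegative, where a non-integrable function has integral 0 by convention,
  and it vanishes at the radii \<open>2 b\<^sub>k\<close>, where the proximity function is
  0.\<close>

lemma pole_deficiency_sq_map: "pole_deficiency sq_map = 0"
proof (rule antisym)
  \<comment> \<open>Without a pole at 0 the term with \<open>ln r\<close>, negative for small
    \<open>r\<close>, drops out.\<close>
  have "\<not> is_pole sq_map 0"
    by (intro analytic_at_imp_no_pole sq_map_analytic dead_regular dead_small) simp
  then have "pole_mult sq_map 0 = 0" by (simp add: pole_mult_def)
  then have "0 \<le> pole_count_integrated r sq_map" for r
    unfolding pole_count_integrated_def by (auto intro!: integral_nonneg_any)
  then have "0 \<le> proximity r sq_map / nevanlinna_T r sq_map" for r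
    unfolding nevanlinna_T_def using proximity_nonneg by (intro divide_nonneg_nonneg add_nonneg_nonneg)
  then show "0 \<le> pole_deficiency sq_map"
    unfolding pole_deficiency_def by (intro Liminf_bounded always_eventually allI) simp
  show "pole_deficiency sq_map \<le> 0"
  proof (rule ccontr)
    assume "\<not> ?thesis"
    then have "0 < Liminf at_top (\<lambda>r :: real. ereal (proximity r sq_map / nevanlinna_T r sq_map))"
      by (simp add: pole_deficiency_def)
    then have "\<forall>\<^sub>F r in at_top. 0 < ereal (proximity r sq_map / nevanlinna_T r sq_map)"
      by (rule less_LiminfD)
    then obtain r0 where r0: "\<And>r. r \<ge> r0 \<Longrightarrow> 0 < ereal (proximity r sq_map / nevanlinna_T r sq_map)"
      unfolding eventually_at_top_linorder by blast
    obtain k where k: "r0 < 2 ^ k" using real_arch_pow[of 2 r0] by auto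
    have "(2::real) ^ k \<le> 2 ^ (outer_exp k + 1)"
      using less_inner_exp(2)[of k] by (intro power_increasing) auto
    then show False using r0[of "2 ^ (outer_exp k + 1)"] k proximity_dead_circle[of k] by simp
  qed
qed

text \<open>A Moebius transformation is injective off its pole, but \<open>sq_map\<close> takes
  equal values at \<open>t\<close> and \<open>- t\<close> in the unit disc.\<close>

lemma sq_map_not_moebius: "\<not> is_moebius sq_map"
proof
  assume "is_moebius sq_map"
  then obtain a b c d where det: "a * d - b * c \<noteq> 0"
    and eq: "\<And>z. c * z + d \<noteq> 0 \<Longrightarrow> sq_map z = (a * z + b) / (c * z + d)"
    unfolding is_moebius_def by blast
  \<comment> \<open>The modulus 1 or 1/2 of \<open>t\<close> is chosen to differ from that of the
    pole \<open>- d / c\<close>.\<close>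
  have "\<exists>t. cmod t \<le> 1 \<and> t \<noteq> 0 \<and> c * t + d \<noteq> 0 \<and> c * (- t) + d \<noteq> 0"
  proof (cases "c = 0")
    case True
    then show ?thesis using det by (intro exI[of _ 1]) auto
  next
    case False
    show ?thesis
    proof (cases "cmod (d / c) = 1")
      case True
      have "c * t + d \<noteq> 0" if "cmod t = 1/2" for t
      proof
        assume "c * t + d = 0"
        then have "d / c = - t" using False by (simp add: field_simps eq_neg_iff_add_eq_0)
        with True that show False by simp
      qed
      from this[of "1/2"] this[of "- 1/2"] show ?thesis by (intro exI[of _ "1/2"]) auto
    next
      case F: False
      have "c * t + d \<noteq> 0" if "cmod t = 1" for t
      proof
        assume "c * t + d = 0"
        then have "d / c = - t" using False by (simp add: field_simps eq_neg_iff_add_eq_0)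
        with F that show False by simp
      qed
      from this[of 1] this[of "- 1"] show ?thesis by (intro exI[of _ 1]) auto
    qed
  qed
  then obtain t where t: "cmod t \<le> 1" "t \<noteq> 0" "c * t + d \<noteq> 0" "c * (- t) + d \<noteq> 0" by blast
  have "sq_map (- t) = sq_map t" by (intro sq_map_minus dead_regular dead_small t)
  then have "(a * (- t) + b) / (c * (- t) + d) = (a * t + b) / (c * t + d)"
    using eq[OF t(3)] eq[OF t(4)] by simp
  then have "(a * (- t) + b) * (c * t + d) = (a * t + b) * (c * (- t) + d)"
    using t(3,4) by (simp add: frac_eq_eq)
  then have "2 * t * (a * d - b * c) = 0" by algebra
  then show False using det t(2) by simp
qed

section \<open>The limit \<open>h\<close> and the annuli covered by the iterates\<close>

lemma growth_ratio_limits: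
  assumes "z \<in> trapped 0" "zs \<in> trapped 0"
  shows "h_upper sq_map zs z = ereal (growth z / growth zs)"
    "h_lower sq_map zs z = ereal (growth z / growth zs)"
proof -
  have "(\<lambda>n. (ln (cmod ((sq_map ^^ n) z)) / 2 ^ n) / (ln (cmod ((sq_map ^^ n) zs)) / 2 ^ n))
      \<longlonglongrightarrow> growth z / growth zs"
    using growth_pos[OF assms(2)] by (intro tendsto_divide growth_lim assms) auto
  moreover have "(ln (cmod ((sq_map ^^ n) z)) / 2 ^ n) / (ln (cmod ((sq_map ^^ n) zs)) / 2 ^ n) = h_seq sq_map zs n z" for n
    by (simp add: h_seq_def trapped_sphere_iter(3)[OF assms(1)] trapped_sphere_iter(3)[OF assms(2)])
  ultimately have "(\<lambda>n. ereal (h_seq sq_map zs n z)) \<longlonglongrightarrow> ereal (growth z / growth zs)" by simp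
  then show "h_upper sq_map zs z = ereal (growth z / growth zs)"
    "h_lower sq_map zs z = ereal (growth z / growth zs)"
    unfolding h_upper_def h_lower_def by (auto intro: lim_imp_Limsup lim_imp_Liminf)
qed

lemma funpow_covers_power_annulus:
  assumes z0: "z0 \<in> trapped 0" and "\<epsilon> > 0"
    and cov: "\<forall>\<^sub>F n in sequentially.
      annulus (cmod ((sq_map ^^ n) z0) * exp (- (2 ^ n * \<epsilon>))) (cmod ((sq_map ^^ n) z0) * exp (2 ^ n * \<epsilon>)) \<subseteq> X n"
  obtains \<alpha> where "0 < \<alpha>" "\<alpha> < 1" "\<forall>\<^sub>F n in sequentially.
    annulus (cmod ((sq_map ^^ n) z0) powr (1 - \<alpha>)) (cmod ((sq_map ^^ n) z0) powr (1 + \<alpha>)) \<subseteq> X n"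
proof -
  define H where "H = growth z0"
  have H: "H > 0" unfolding H_def using z0 by (rule growth_pos)
  \<comment> \<open>In logarithms the annulus has half-width \<open>l * \<alpha>\<close>, where
    eventually \<open>l < 2 ^ n * (2 * H)\<close>; this choice makes it at most
    \<open>2 ^ n * \<epsilon>\<close>.\<close>
  define \<alpha> where "\<alpha> = min (1/2) (\<epsilon> / (2 * H))"
  have \<alpha>: "0 < \<alpha>" "\<alpha> < 1" using H \<open>\<epsilon> > 0\<close> by (auto simp: \<alpha>_def)
  have "\<alpha> \<le> \<epsilon> / (2 * H)" by (simp add: \<alpha>_def)
  then have \<alpha>\<epsilon>: "2 * H * \<alpha> \<le> \<epsilon>" using H by (simp add: field_simps)
  have "\<forall>\<^sub>F n in sequentially. ln (cmod ((sq_map ^^ n) z0)) / 2 ^ n < 2 * H"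
    using order_tendstoD(2)[OF growth_lim[OF z0], of "2 * H"] H by (simp add: H_def)
  with cov have "\<forall>\<^sub>F n in sequentially.
    annulus (cmod ((sq_map ^^ n) z0) powr (1 - \<alpha>)) (cmod ((sq_map ^^ n) z0) powr (1 + \<alpha>)) \<subseteq> X n"
  proof eventually_elim
    case (elim n)
    define l where "l = ln (cmod ((sq_map ^^ n) z0))"
    have w: "cmod ((sq_map ^^ n) z0) > 0" using trapped_nonzero[OF z0, of n] by linarith
    have "l < 2 ^ n * (2 * H)" using elim(2) by (simp add: l_def field_simps)
    then have "l * \<alpha> \<le> 2 ^ n * (2 * H) * \<alpha>" using \<alpha> by (intro mult_right_mono) auto
    also have "\<dots> \<le> 2 ^ n * \<epsilon>" using \<alpha>\<epsilon> by (simp add: mult.assoc)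
    finally have l\<alpha>: "l * \<alpha> \<le> 2 ^ n * \<epsilon>" .
    have e: "cmod ((sq_map ^^ n) z0) = exp l" using w by (simp add: l_def)
    have pw: "cmod ((sq_map ^^ n) z0) powr q = exp (l * q)" for q
      using w by (simp add: powr_def l_def mult.commute)
    have "cmod ((sq_map ^^ n) z0) powr (1 + \<alpha>) \<le> cmod ((sq_map ^^ n) z0) * exp (2 ^ n * \<epsilon>)"
      unfolding pw unfolding e exp_add[symmetric] using l\<alpha> by (simp add: distrib_left)
    moreover have "cmod ((sq_map ^^ n) z0) * exp (- (2 ^ n * \<epsilon>)) \<le> cmod ((sq_map ^^ n) z0) powr (1 - \<alpha>)"
      unfolding pw unfolding e exp_add[symmetric] using l\<alpha> by (simp add: right_diff_distrib)
    ultimately show ?case using elim(1) unfolding annulus_def by fastforce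
  qed
  with \<alpha> that show thesis by blast
qed

text \<open>In logarithmic scale the annuli are intervals from \<open>2 ^ n * x - 1\<close> to
  \<open>2 ^ n * y + 1\<close> with \<open>x < H < y\<close>. They are mapped over each other by
  \<open>sq_map_covers\<close>; the ratio \<open>y / x > 1\<close> and the different growth of
  \<open>a\<close> and \<open>b\<close> leave room for \<open>\<tau>\<close>.\<close>

lemma funpow_nested_annuli:
  assumes B: "B \<subseteq> trapped 0" and z0: "z0 \<in> B" and "\<epsilon> > 0"
    and cov: "\<forall>\<^sub>F n in sequentially.
      annulus (cmod ((sq_map ^^ n) z0) * exp (- (2 ^ n * \<epsilon>))) (cmod ((sq_map ^^ n) z0) * exp (2 ^ n * \<epsilon>))
        \<subseteq> (sq_map ^^ n) ` B"
    and ab: "a \<in> B" "b \<in> B" "growth a < growth b"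
  shows "\<exists>\<tau>>1. \<exists>r R :: nat \<Rightarrow> real.
            (\<forall>\<^sub>F n in sequentially.
               cmod ((sq_map ^^ n) a) powr \<tau> \<le> cmod ((sq_map ^^ n) b) \<and>
               0 < r n \<and> r n < R n \<and>
               annulus (r n) (R n) \<subseteq> (sq_map ^^ n) ` B \<and>
               R n \<ge> r n powr \<tau> \<and>
               annulus (r (Suc n)) (R (Suc n)) \<subseteq> sq_map ` annulus (r n) (R n)) \<and>
            filterlim (\<lambda>n. r n powr \<tau>) at_top sequentially"
proof -
  define H where "H = growth z0"
  have tr: "z0 \<in> trapped 0" "a \<in> trapped 0" "b \<in> trapped 0" using B z0 ab by auto
  have H: "H > 0" "growth a > 0" unfolding H_def using tr by (auto intro: growth_pos)
  \<comment> \<open>The bound \<open>\<epsilon> / 2\<close> leaves room inside the covered annulus,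
    and \<open>H / 2\<close> keeps \<open>x\<close> positive.\<close>
  define \<eta> where "\<eta> = min (\<epsilon> / 2) (H / 2)"
  define x where "x = H - \<eta>"
  define y where "y = H + \<eta>"
  have \<eta>: "0 < \<eta>" "\<eta> \<le> \<epsilon> / 2" "\<eta> \<le> H / 2" using H \<open>\<epsilon> > 0\<close> by (auto simp: \<eta>_def)
  have xy: "0 < x" "x < y" using H \<eta> by (auto simp: x_def y_def)
  define q where "q = growth b / growth a"
  have q: "1 < q" using ab(3) H by (simp add: q_def)
  \<comment> \<open>At most \<open>y / x\<close> for \<open>R n \<ge> r n powr \<tau>\<close>, and
    strictly below the growth ratio \<open>q\<close> for the inequality between \<open>a\<close> and
    \<open>b\<close>.\<close>
  define \<tau> where "\<tau> = min (y / x) ((1 + q) / 2)"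
  have \<tau>: "1 < \<tau>" using q xy by (auto simp: \<tau>_def)
  have "\<tau> \<le> y / x" by (simp add: \<tau>_def)
  then have \<tau>xy: "\<tau> * x \<le> y" using xy by (simp add: field_simps)
  have "\<tau> \<le> (1 + q) / 2" unfolding \<tau>_def by (rule min.cobounded2)
  also have "(1 + q) / 2 < q" using q by (simp add: field_simps)
  finally have "\<tau> < q" .
  then have \<tau>ab: "\<tau> * growth a < growth b" using H by (simp add: q_def field_simps)
  \<comment> \<open>The shifts -1 and 1 are the fixed points of \<open>s \<mapsto> 2 * s + 1\<close>
    and \<open>t \<mapsto> 2 * t - 1\<close> from \<open>sq_map_covers\<close>, so the radii at
    \<open>n\<close> lead exactly to those at \<open>Suc n\<close>.\<close>
  define r where "r n = exp (2 ^ n * x - 1)" for n :: nat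
  define R where "R n = exp (2 ^ n * y + 1)" for n :: nat
  have "(\<lambda>n. ln (cmod ((sq_map ^^ n) b)) / 2 ^ n - \<tau> * (ln (cmod ((sq_map ^^ n) a)) / 2 ^ n)) \<longlonglongrightarrow>
      growth b - \<tau> * growth a"
    by (intro tendsto_intros growth_lim tr)
  then have ev1: "\<forall>\<^sub>F n in sequentially. 0 < ln (cmod ((sq_map ^^ n) b)) / 2 ^ n - \<tau> * (ln (cmod ((sq_map ^^ n) a)) / 2 ^ n)"
    using \<tau>ab by (intro order_tendstoD(1)) auto
  have ev2: "\<forall>\<^sub>F n in sequentially. H - \<epsilon> / 4 < ln (cmod ((sq_map ^^ n) z0)) / 2 ^ n"
    "\<forall>\<^sub>F n in sequentially. ln (cmod ((sq_map ^^ n) z0)) / 2 ^ n < H + \<epsilon> / 4"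
    using \<open>\<epsilon> > 0\<close> by (auto intro!: order_tendstoD[OF growth_lim[OF tr(1)]] simp: H_def)
  \<comment> \<open>This quarter of the logarithmic half-width pays for the shifts by 1.\<close>
  have ev3: "\<forall>\<^sub>F n in sequentially. 2 \<le> 2 ^ n * (\<epsilon> / 4)"
    by (rule two_power_mult_at_top[unfolded filterlim_at_top, rule_format]) (use \<open>\<epsilon> > 0\<close> in simp)
  have "\<forall>\<^sub>F n in sequentially.
               cmod ((sq_map ^^ n) a) powr \<tau> \<le> cmod ((sq_map ^^ n) b) \<and>
               0 < r n \<and> r n < R n \<and>
               annulus (r n) (R n) \<subseteq> (sq_map ^^ n) ` B \<and>
               R n \<ge> r n powr \<tau> \<and>
               annulus (r (Suc n)) (R (Suc n)) \<subseteq> sq_map ` annulus (r n) (R n)"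
    using ev1 ev2(1) ev2(2) ev3 cov
  proof eventually_elim
    case (elim n)
    have pos: "cmod ((sq_map ^^ n) z) > 0" if "z \<in> trapped 0" for z
      using trapped_nonzero[OF that, of n] by linarith
    have "0 < 2 ^ n * (ln (cmod ((sq_map ^^ n) b)) / 2 ^ n - \<tau> * (ln (cmod ((sq_map ^^ n) a)) / 2 ^ n))"
      using elim(1) by simp
    then have "\<tau> * ln (cmod ((sq_map ^^ n) a)) \<le> ln (cmod ((sq_map ^^ n) b))"
      by (simp add: right_diff_distrib)
    then have "exp (\<tau> * ln (cmod ((sq_map ^^ n) a))) \<le> exp (ln (cmod ((sq_map ^^ n) b)))"
      by (rule exp_le_cancel_iff[THEN iffD2])
    also have "\<dots> = cmod ((sq_map ^^ n) b)" using pos[OF tr(3)] by (rule exp_ln)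
    finally have 1: "cmod ((sq_map ^^ n) a) powr \<tau> \<le> cmod ((sq_map ^^ n) b)"
      using pos[OF tr(2)] by (simp add: powr_def)
    have Nx: "2 ^ n * x < 2 ^ n * y" using xy by simp
    then have "2 ^ n * x - 1 < 2 ^ n * y + 1" by linarith
    then have 2: "0 < r n" "r n < R n" by (simp_all only: r_def R_def exp_less_cancel_iff exp_gt_zero)
    define l where "l = ln (cmod ((sq_map ^^ n) z0))"
    have el: "cmod ((sq_map ^^ n) z0) = exp l" using pos[OF tr(1)] by (simp add: l_def)
    have "2 ^ n * (H - \<epsilon> / 4) < l" "l < 2 ^ n * (H + \<epsilon> / 4)"
      using elim(2,3) by (simp_all add: l_def field_simps)
    moreover have "2 ^ n * (H - \<epsilon> / 2) \<le> 2 ^ n * x" "2 ^ n * y \<le> 2 ^ n * (H + \<epsilon> / 2)"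
      using \<eta> by (auto simp: x_def y_def)
    ultimately have "l - 2 ^ n * \<epsilon> < 2 ^ n * x - 1" "2 ^ n * y + 1 < l + 2 ^ n * \<epsilon>"
      using elim(4) by (simp_all add: algebra_simps)
    then have "cmod ((sq_map ^^ n) z0) * exp (- (2 ^ n * \<epsilon>)) < r n" "R n < cmod ((sq_map ^^ n) z0) * exp (2 ^ n * \<epsilon>)"
      unfolding el exp_add[symmetric] r_def R_def by simp_all
    \<comment> \<open>The strict inequalities cover even the closed annulus, as
      \<open>sq_map_covers\<close> requires.\<close>
    then have "{z. r n \<le> cmod z \<and> cmod z \<le> R n} \<subseteq>
      annulus (cmod ((sq_map ^^ n) z0) * exp (- (2 ^ n * \<epsilon>))) (cmod ((sq_map ^^ n) z0) * exp (2 ^ n * \<epsilon>))"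
      unfolding annulus_def by auto
    with elim(5) have cl: "{z. r n \<le> cmod z \<and> cmod z \<le> R n} \<subseteq> (sq_map ^^ n) ` B" by blast
    then have 3: "annulus (r n) (R n) \<subseteq> (sq_map ^^ n) ` B" unfolding annulus_def by auto
    have "(sq_map ^^ n) ` B \<subseteq> trapped n" using trapped_funpow[of _ 0 n] B by auto
    then have "(sq_map ^^ n) ` B \<subseteq> open_ann n" using trapped_subset_open_ann by blast
    with cl have "{z. exp (2 ^ n * x - 1) \<le> cmod z \<and> cmod z \<le> exp (2 ^ n * y + 1)} \<subseteq> open_ann n"
      by (auto simp: r_def R_def)
    moreover have "2 \<le> (2 ^ n * y + 1) - (2 ^ n * x - 1)" using Nx by linarith
    ultimately have "annulus (exp (2 * (2 ^ n * x - 1) + 1)) (exp (2 * (2 ^ n * y + 1) - 1)) \<subseteq> sq_map ` annulus (r n) (R n)"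
      unfolding r_def R_def by (rule sq_map_covers)
    moreover have "2 * (2 ^ n * x - 1) + 1 = 2 ^ Suc n * x - 1" "2 * (2 ^ n * y + 1) - 1 = 2 ^ Suc n * y + 1"
      by simp_all
    ultimately have 4: "annulus (r (Suc n)) (R (Suc n)) \<subseteq> sq_map ` annulus (r n) (R n)"
      by (simp only: r_def R_def)
    have "2 ^ n * (\<tau> * x) \<le> 2 ^ n * y" using \<tau>xy by simp
    moreover have "(2 ^ n * x - 1) * \<tau> = 2 ^ n * (\<tau> * x) - \<tau>" by (simp add: algebra_simps)
    ultimately have "(2 ^ n * x - 1) * \<tau> \<le> 2 ^ n * y + 1" using \<tau> by linarith
    then have 5: "r n powr \<tau> \<le> R n"
      by (simp only: r_def R_def powr_def ln_exp exp_not_eq_zero if_False exp_le_cancel_iff mult.commute[of \<tau>])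
    from 1 2 3 4 5 show ?case by blast
  qed
  moreover have "filterlim (\<lambda>n. r n powr \<tau>) at_top sequentially"
  proof -
    have "filterlim (\<lambda>n. - \<tau> + 2 ^ n * (\<tau> * x)) at_top sequentially"
      using \<tau> xy by (intro filterlim_tendsto_add_at_top[OF tendsto_const] two_power_mult_at_top) simp
    from filterlim_compose[OF exp_at_top this]
    show ?thesis by (simp add: r_def powr_def algebra_simps)
  qed
  ultimately show ?thesis using \<tau> by blast
qed

section \<open>The wandering domain\<close>

text \<open>The base point is the geometric mean of the radii \<open>2 ^ 33\<close> and
  \<open>2 ^ 47\<close> of the annulus in \<open>seed_trapped\<close>.\<close>

definition wander :: "complex set" where
  "wander = connected_component_set (interior (trapped 0)) (2 ^ 40)"

lemma annulus_subset_wander: "annulus (2 ^ 33) (2 ^ 47) \<subseteq> wander"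
proof -
  have "open (annulus (2 ^ 33) (2 ^ 47))"
    unfolding annulus_def by (intro open_Collect_conj open_Collect_less continuous_intros)
  moreover have "annulus (2 ^ 33) (2 ^ 47) \<subseteq> trapped 0"
    using seed_trapped by (auto simp: annulus_def)
  ultimately have "annulus (2 ^ 33) (2 ^ 47) \<subseteq> interior (trapped 0)" by (simp add: interior_maximal)
  moreover have "connected (annulus (2 ^ 33) (2 ^ 47))"
    using connected_annulus(1)[of "2 ^ 33" "0::complex" "2 ^ 47"] by (simp add: annulus_def)
  moreover have "2 ^ 40 \<in> annulus (2 ^ 33) (2 ^ 47)" by (simp add: annulus_def norm_power)
  ultimately show ?thesis unfolding wander_def by (intro connected_component_maximal)
qed

lemma wander_props:
  shows open_wander: "open wander" and connected_wander: "connected wander"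
    and wander_subset: "wander \<subseteq> interior (trapped 0)"
  unfolding wander_def
  by (simp_all add: open_connected_component connected_component_subset)

text \<open>At \<open>2 ^ 34\<close> and \<open>2 ^ 46\<close> the values are within 1/8 of
  \<open>34 * ln 2\<close> and \<open>46 * ln 2\<close>.\<close>

lemma growth_nonconstant_wander: "\<not> growth constant_on wander"
proof
  assume "growth constant_on wander"
  moreover have "2 ^ 34 \<in> wander" "2 ^ 46 \<in> wander"
    using annulus_subset_wander by (auto simp: annulus_def norm_power)
  ultimately have eq: "growth (2 ^ 34) = growth (2 ^ 46)" by (auto simp: constant_on_def)
  have "\<bar>growth (2 ^ k) - k * ln 2\<bar> \<le> 1/8" if "33 \<le> k" "k \<le> 47" for k :: nat
  proof -
    have "(2::real) ^ 33 \<le> 2 ^ k" "(2::real) ^ k \<le> 2 ^ 47" using that by (intro power_increasing; simp)+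
    then have "2 ^ k \<in> trapped 0" by (intro seed_trapped) (simp_all add: norm_power)
    from growth_bound[OF this] show ?thesis by (simp add: norm_power ln_realpow)
  qed
  from this[of 34] this[of 46] eq show False using ln2_ge_two_thirds by (simp add: abs_if split: if_splits)
qed

theorem theorem4:
  shows "\<exists>f :: complex \<Rightarrow> complex.
    f nicely_meromorphic_on UNIV \<and> \<not> is_moebius f \<and> pole_deficiency f = 0 \<and>
    (\<exists>W :: complex set.
      wandering_domain f (Fin ` W) \<and>
      escaping f (Fin ` W) \<and>
      (\<forall>zs\<in>W. \<exists>h :: complex \<Rightarrow> real.
          (\<forall>z\<in>W. h_upper f zs z = ereal (h z) \<and> h_lower f zs z = ereal (h z)) \<and>
          harmonic_on W h \<and> (\<forall>z\<in>W. h z > 0) \<and> \<not> h constant_on W) \<and>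
      (\<forall>z0\<in>W. \<forall>V. V \<subseteq> W \<and> z0 \<in> interior V \<longrightarrow>
          (\<exists>\<alpha>. 0 < \<alpha> \<and> \<alpha> < 1 \<and>
            (\<forall>\<^sub>F n in sequentially.
               annulus (cmod (iter f n z0) powr (1 - \<alpha>)) (cmod (iter f n z0) powr (1 + \<alpha>))
                 \<subseteq> iter f n ` V)) \<and>
          (\<exists>a\<in>V. \<exists>b\<in>V. \<exists>\<tau>>1. \<exists>r R :: nat \<Rightarrow> real.
            (\<forall>\<^sub>F n in sequentially.
               cmod (iter f n a) powr \<tau> \<le> cmod (iter f n b) \<and>
               0 < r n \<and> r n < R n \<and>
               annulus (r n) (R n) \<subseteq> iter f n ` V \<and>
               R n \<ge> r n powr \<tau> \<and>
               annulus (r (Suc n)) (R (Suc n)) \<subseteq> f ` annulus (r n) (R n)) \<and>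
            filterlim (\<lambda>n. r n powr \<tau>) at_top sequentially)))"
proof -
  have W: "z \<in> trapped 0" if "z \<in> wander" for z using that wander_subset interior_subset by blast
  have "2 ^ 40 \<in> annulus (2 ^ 33) (2 ^ 47)" by (simp add: annulus_def norm_power)
  then have p: "2 ^ 40 \<in> interior (trapped 0)" using annulus_subset_wander wander_subset by blast
  have it: "iter sq_map n z = (sq_map ^^ n) z" if "z \<in> wander" for n z
    by (rule trapped_sphere_iter(3)[OF W[OF that]])
  have wd: "wandering_domain sq_map (Fin ` wander)"
    unfolding wander_def by (rule wandering_trapped[OF p])
  have esc: "escaping sq_map (Fin ` wander)" by (rule escaping_trapped[of _ 0]) (use W in blast)
  have a: "\<exists>h :: complex \<Rightarrow> real.
          (\<forall>z\<in>wander. h_upper sq_map zs z = ereal (h z) \<and> h_lower sq_map zs z = ereal (h z)) \<and>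
          harmonic_on wander h \<and> (\<forall>z\<in>wander. h z > 0) \<and> \<not> h constant_on wander" if zs: "zs \<in> wander" for zs
  proof (intro exI[of _ "\<lambda>z. growth z / growth zs"] conjI ballI)
    have pos: "growth zs > 0" by (rule growth_pos[OF W[OF zs]])
    show "\<not> (\<lambda>z. growth z / growth zs) constant_on wander"
    proof
      assume "(\<lambda>z. growth z / growth zs) constant_on wander"
      then obtain c where "\<And>z. z \<in> wander \<Longrightarrow> growth z / growth zs = c" by (auto simp: constant_on_def)
      then have "growth z = c * growth zs" if "z \<in> wander" for z using that pos by (auto simp: field_simps)
      then have "growth constant_on wander" by (auto simp: constant_on_def)
      then show False using growth_nonconstant_wander by blast
    qed
    show "harmonic_on wander (\<lambda>z. growth z / growth zs)"
      by (rule growth_harmonic[OF open_wander wander_subset])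
    fix z assume z: "z \<in> wander"
    show "0 < growth z / growth zs" using growth_pos[OF W[OF z]] pos by simp
    show "h_upper sq_map zs z = ereal (growth z / growth zs)" "h_lower sq_map zs z = ereal (growth z / growth zs)"
      using growth_ratio_limits[OF W[OF z] W[OF zs]] by auto
  qed
  have bc: "(\<exists>\<alpha>. 0 < \<alpha> \<and> \<alpha> < 1 \<and>
            (\<forall>\<^sub>F n in sequentially.
               annulus (cmod (iter sq_map n z0) powr (1 - \<alpha>)) (cmod (iter sq_map n z0) powr (1 + \<alpha>))
                 \<subseteq> iter sq_map n ` V)) \<and>
          (\<exists>a\<in>V. \<exists>b\<in>V. \<exists>\<tau>>1. \<exists>r R :: nat \<Rightarrow> real.
            (\<forall>\<^sub>F n in sequentially.
               cmod (iter sq_map n a) powr \<tau> \<le> cmod (iter sq_map n b) \<and>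
               0 < r n \<and> r n < R n \<and>
               annulus (r n) (R n) \<subseteq> iter sq_map n ` V \<and>
               R n \<ge> r n powr \<tau> \<and>
               annulus (r (Suc n)) (R (Suc n)) \<subseteq> sq_map ` annulus (r n) (R n)) \<and>
            filterlim (\<lambda>n. r n powr \<tau>) at_top sequentially)"
    if z0: "z0 \<in> wander" and V: "V \<subseteq> wander" "z0 \<in> interior V" for z0 V
  proof -
    have z0V: "z0 \<in> V" using V(2) interior_subset by blast
    have VT: "V \<subseteq> trapped 0" using V(1) W by blast
    have imV: "iter sq_map n ` V = (sq_map ^^ n) ` V" for n
      using V(1) it by (intro image_cong) auto
    \<comment> \<open>Non-constancy on \<open>wander\<close> passes to every nonempty open subset by
      the identity theorem.\<close>
    have nc: "\<not> growth constant_on S" if "open S" "S \<noteq> {}" "S \<subseteq> interior V" for S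
      using that V(1) interior_subset[of V]
      by (intro growth_locally_nonconstant[OF open_wander connected_wander wander_subset growth_nonconstant_wander]) auto
    have "interior V \<subseteq> interior (trapped 0)" using VT by (rule interior_mono)
    then obtain \<epsilon> where \<epsilon>: "\<epsilon> > 0" "\<forall>\<^sub>F n in sequentially.
        annulus (cmod ((sq_map ^^ n) z0) * exp (- (2 ^ n * \<epsilon>))) (cmod ((sq_map ^^ n) z0) * exp (2 ^ n * \<epsilon>))
          \<subseteq> (sq_map ^^ n) ` interior V"
      using funpow_covers_annulus[OF open_interior V(2) _ nc] by blast
    from \<epsilon>(2) have cov: "\<forall>\<^sub>F n in sequentially.
        annulus (cmod ((sq_map ^^ n) z0) * exp (- (2 ^ n * \<epsilon>))) (cmod ((sq_map ^^ n) z0) * exp (2 ^ n * \<epsilon>))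
          \<subseteq> (sq_map ^^ n) ` V"
      by eventually_elim (use interior_subset[of V] in blast)
    obtain \<alpha> where \<alpha>: "0 < \<alpha>" "\<alpha> < 1" "\<forall>\<^sub>F n in sequentially.
        annulus (cmod ((sq_map ^^ n) z0) powr (1 - \<alpha>)) (cmod ((sq_map ^^ n) z0) powr (1 + \<alpha>)) \<subseteq> (sq_map ^^ n) ` V"
      using funpow_covers_power_annulus[OF W[OF z0] \<epsilon>(1) cov] by blast
    have "\<not> growth constant_on interior V" using nc[of "interior V"] V(2) by blast
    \<comment> \<open>Some point of \<open>V\<close> grows at a rate different from that of
      \<open>z0\<close>; ordering the two yields \<open>a\<close> and \<open>b\<close>.\<close>
    then obtain w where w: "w \<in> V" "growth w \<noteq> growth z0"
      using interior_subset[of V] unfolding constant_on_def by blast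
    then obtain a b where ab: "a \<in> V" "b \<in> V" "growth a < growth b"
      using z0V by (metis linorder_neqE_linordered_idom)
    note ab_it = it[OF subsetD[OF V(1) ab(1)]] it[OF subsetD[OF V(1) ab(2)]]
    show ?thesis
      unfolding it[OF z0] imV
    proof (rule conjI)
      have "\<exists>\<tau>>1. \<exists>r R :: nat \<Rightarrow> real.
            (\<forall>\<^sub>F n in sequentially.
               cmod (iter sq_map n a) powr \<tau> \<le> cmod (iter sq_map n b) \<and>
               0 < r n \<and> r n < R n \<and>
               annulus (r n) (R n) \<subseteq> (sq_map ^^ n) ` V \<and>
               R n \<ge> r n powr \<tau> \<and>
               annulus (r (Suc n)) (R (Suc n)) \<subseteq> sq_map ` annulus (r n) (R n)) \<and>
            filterlim (\<lambda>n. r n powr \<tau>) at_top sequentially"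
        unfolding ab_it by (rule funpow_nested_annuli[OF VT z0V \<epsilon>(1) cov ab])
      then show "\<exists>a\<in>V. \<exists>b\<in>V. \<exists>\<tau>>1. \<exists>r R :: nat \<Rightarrow> real.
            (\<forall>\<^sub>F n in sequentially.
               cmod (iter sq_map n a) powr \<tau> \<le> cmod (iter sq_map n b) \<and>
               0 < r n \<and> r n < R n \<and>
               annulus (r n) (R n) \<subseteq> (sq_map ^^ n) ` V \<and>
               R n \<ge> r n powr \<tau> \<and>
               annulus (r (Suc n)) (R (Suc n)) \<subseteq> sq_map ` annulus (r n) (R n)) \<and>
            filterlim (\<lambda>n. r n powr \<tau>) at_top sequentially" by (intro bexI[OF bexI[OF _ ab(2)] ab(1)])
      show "\<exists>\<alpha>. 0 < \<alpha> \<and> \<alpha> < 1 \<and>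
            (\<forall>\<^sub>F n in sequentially.
               annulus (cmod ((sq_map ^^ n) z0) powr (1 - \<alpha>)) (cmod ((sq_map ^^ n) z0) powr (1 + \<alpha>))
                 \<subseteq> (sq_map ^^ n) ` V)"
        using \<alpha> by blast
    qed
  qed
  show ?thesis
    by (intro exI[of _ sq_map] exI[of _ wander] conjI ballI allI impI sq_map_meromorphic sq_map_not_moebius
        pole_deficiency_sq_map wd esc a) (use bc in auto)
qed

end
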